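(* Let $\lambda$ be a composition of $n$ and suppose $\lambda$ is a rearrangement of the hook partition $(m,1^{r-1})$ (one part equal to $m$ and $r-1$ parts equal to $1$), where $m>1$ and $r\ge 3$. Suppose further that neither $\lambda$ nor its reverse $\dot\lambda$ is a partition. Then $$Y(\lambda)=\{w_D: D\in\mathcal D^{(\lambda)}\text{ and }\mu_D''=\lambda'\}.$$ In particular, $Y(\lambda)=Y_s(\lambda)$ and $|Y(\lambda)|=m$.
   Context: Permutations. $S_n$ acts on $\{1,\dots,n\}$ on the right ($iw$ is the image of $i$ under $w$; $xy$ means first $x$, then $y$). $s_i=(i,i+1)$ and $l$ is the Coxeter length with respect to the $s_i$. An element $x$ is a prefix of $y$ if $l(y)=l(x)+l(x^{-1}y)$. Right cells. The row-form of $w\in S_n$ is $[1w,2w,\dots,nw]$; $\mathcal P(w),\mathcal Q(w)$ are the insertion and recording tableaux obtained by Robinson–Schensted row insertion of the row-form. $\sim_R$ denotes the Kazhdan–Lusztig right cell equivalence; in $S_n$, $x\sim_R y$ if and only if $\mathcal Q(x)=\mathcal Q(y)$ (known theorem, may be taken as the definition). Compositions. Compositions have no zero parts. For $\lambda=(\lambda_1,\dots,\lambda_r)$ a composition of $n$: $\dot\lambda=(\lambda_r,\dots,\lambda_1)$; $\lambda'$ is the partition with $\lambda'_i=|\{j:\lambda_j\ge i\}|$ for $1\le i\le\max_j\lambda_j$ (so $\lambda''$ is the rearrangement of $\lambda$ in weakly decreasing order); $J(\lambda)=\{s_1,\dots,s_{n-1}\}\setminus\{s_{\lambda_1},s_{\lambda_1+\lambda_2},\dots,s_{\lambda_1+\dots+\lambda_{r-1}}\}$;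 $w_{J(\lambda)}$ is the longest element of the parabolic subgroup $W_{J(\lambda)}=\langle J(\lambda)\rangle$; $\mathfrak X_{J(\lambda)}$ is the set of minimum length representatives of the right cosets of $W_{J(\lambda)}$ in $S_n$. Diagrams. A (principal) diagram $D$ is a finite subset of $\mathbb Z^2$ whose nodes $(a,b)$ (row $a$, column $b$) have rows indexed consecutively from $1$ and columns indexed consecutively from $1$, with no empty row or column; its row-composition $\lambda_D$ and column-composition $\mu_D$ count the nodes in each row and in each column. $\mathcal D^{(\lambda)}$ is the set of principal diagrams $D$ with $\lambda_D=\lambda$. For $D$ with $n$ nodes, $t^D$ and $t_D$ are the bijections $D\to\{1,\dots,n\}$ obtained by filling in $1,\dots,n$ row by row (top to bottom, left to right) and column by column (left to right, top to bottom), respectively, and $w_D\in S_n$ is defined by $t^Dw_D=t_D$. A diagram is special if it is obtained from a Young diagram by permuting the rows and the columns. Define $Z(\lambda)=\{e\in\mathfrak X_{J(\lambda)}: w_{J(\lambda)}e\sim_R w_{J(\lambda)}\}$, $Z_s(\lambda)=\{e\in Z(\lambda): e=w_D$ for some special diagram $D\in\mathcal D^{(\lambda)}\}$, $Y(\lambda)=\{x\in Z(\lambda): x$ is not a prefix of any other $y\in Z(\lambda)\}$, $Y_s(\lambda)=Y(\lambda)\cap Z_s(\lambda)$. *)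

theory Defs
  imports "HOL-Algebra.Sym_Groups" "HOL-Library.Multiset"
begin

section \<open>Permutations\<close>

text \<open>
  Elements of the symmetric group are the functions in the carrier of \<^term>\<open>sym_group n\<close>.
  They act on the right: the image of \<open>i\<close> under \<open>w\<close> is \<open>w i\<close>, and the product \<open>x \<Zsemi> y\<close> means
  first \<open>x\<close>, then \<open>y\<close>. This is the opposite of the multiplication of \<^term>\<open>sym_group n\<close>,
  which has the same subgroups and inverses.
\<close>

definition rmult :: "(nat \<Rightarrow> nat) \<Rightarrow> (nat \<Rightarrow> nat) \<Rightarrow> nat \<Rightarrow> nat"  (infixl "\<Zsemi>" 70)
  where "x \<Zsemi> y = y \<circ> x"

abbreviation Sn :: "nat \<Rightarrow> (nat \<Rightarrow> nat) set"
  where "Sn n \<equiv> carrier (sym_group n)"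

definition simple_refl :: "nat \<Rightarrow> nat \<Rightarrow> nat"
  where "simple_refl i = transpose i (Suc i)"

definition word_prod :: "nat list \<Rightarrow> nat \<Rightarrow> nat"
  where "word_prod is = foldr (\<lambda>i w. simple_refl i \<Zsemi> w) is id"

definition cox_length :: "nat \<Rightarrow> (nat \<Rightarrow> nat) \<Rightarrow> nat"
  where "cox_length n w =
    (LEAST k. \<exists>is. set is \<subseteq> {1..<n} \<and> length is = k \<and> word_prod is = w)"

definition is_prefix :: "nat \<Rightarrow> (nat \<Rightarrow> nat) \<Rightarrow> (nat \<Rightarrow> nat) \<Rightarrow> bool"
  where "is_prefix n x y \<longleftrightarrow> cox_length n y = cox_length n x + cox_length n (inv' x \<Zsemi> y)"


section \<open>Robinson-Schensted insertion and right cells\<close>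

type_synonym tableau = "nat list list"

text \<open>The second component is the bumped entry, if any.\<close>

fun row_insert :: "nat \<Rightarrow> nat list \<Rightarrow> nat list \<times> nat option" where
  "row_insert x [] = ([x], None)"
| "row_insert x (y # ys) =
     (if x < y then (x # ys, Some y)
      else (let (ys', b) = row_insert x ys in (y # ys', b)))"

text \<open>The second component is the index (from 0) of the row in which the new box appears.\<close>

fun tab_insert :: "nat \<Rightarrow> tableau \<Rightarrow> tableau \<times> nat" where
  "tab_insert x [] = ([[x]], 0)"
| "tab_insert x (R # T) =
     (case row_insert x R of
        (R', None) \<Rightarrow> (R' # T, 0)
      | (R', Some y) \<Rightarrow> (let (T', k) = tab_insert y T in (R' # T', Suc k)))"

fun add_to_row :: "nat \<Rightarrow> nat \<Rightarrow> tableau \<Rightarrow> tableau" where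
  "add_to_row k i [] = [[i]]"
| "add_to_row 0 i (R # T) = (R @ [i]) # T"
| "add_to_row (Suc k) i (R # T) = R # add_to_row k i T"

fun rs_step :: "tableau \<times> tableau \<Rightarrow> nat \<times> nat \<Rightarrow> tableau \<times> tableau" where
  "rs_step (P, Q) (i, x) = (let (P', k) = tab_insert x P in (P', add_to_row k i Q))"

definition row_form :: "nat \<Rightarrow> (nat \<Rightarrow> nat) \<Rightarrow> nat list"
  where "row_form n w = map w [1..<Suc n]"

definition RS :: "nat \<Rightarrow> (nat \<Rightarrow> nat) \<Rightarrow> tableau \<times> tableau"
  where "RS n w = foldl rs_step ([], []) (enumerate 1 (row_form n w))"

definition recording_tableau :: "nat \<Rightarrow> (nat \<Rightarrow> nat) \<Rightarrow> tableau"
  where "recording_tableau n w = snd (RS n w)"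

text \<open>
  For the symmetric group the Kazhdan-Lusztig right cells are the sets of elements
  with a common recording tableau; this description is taken as the definition.
\<close>

definition right_cell_equiv :: "nat \<Rightarrow> (nat \<Rightarrow> nat) \<Rightarrow> (nat \<Rightarrow> nat) \<Rightarrow> bool"
  where "right_cell_equiv n x y \<longleftrightarrow> recording_tableau n x = recording_tableau n y"


section \<open>Compositions\<close>

definition is_composition :: "nat \<Rightarrow> nat list \<Rightarrow> bool"
  where "is_composition n lam \<longleftrightarrow> 0 \<notin> set lam \<and> sum_list lam = n"

definition is_partition :: "nat list \<Rightarrow> bool"
  where "is_partition lam \<longleftrightarrow> 0 \<notin> set lam \<and> sorted_wrt (\<ge>) lam"

text \<open>Inserting 0 only gives the empty composition an empty conjugate.\<close>

definition conjugate :: "nat list \<Rightarrow> nat list"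
  where "conjugate lam =
    map (\<lambda>i. card {j. j < length lam \<and> lam ! j \<ge> i}) [1..<Suc (Max (insert 0 (set lam)))]"

definition J :: "nat list \<Rightarrow> (nat \<Rightarrow> nat) set"
  where "J lam = simple_refl ` {1..<sum_list lam}
                 - (\<lambda>k. simple_refl (sum_list (take k lam))) ` {1..<length lam}"

definition W_J :: "nat list \<Rightarrow> (nat \<Rightarrow> nat) set"
  where "W_J lam = generate (sym_group (sum_list lam)) (J lam)"

definition longest_J :: "nat list \<Rightarrow> nat \<Rightarrow> nat"
  where "longest_J lam = arg_max (cox_length (sum_list lam)) (\<lambda>w. w \<in> W_J lam)"

definition X_J :: "nat list \<Rightarrow> (nat \<Rightarrow> nat) set"
  where "X_J lam = {e \<in> Sn (sum_list lam).
    \<forall>u \<in> W_J lam. cox_length (sum_list lam) e \<le> cox_length (sum_list lam) (u \<Zsemi> e)}"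


section \<open>Diagrams\<close>

type_synonym diagram = "(int \<times> int) set"

definition principal :: "diagram \<Rightarrow> bool"
  where "principal D \<longleftrightarrow> finite D \<and>
    fst ` D = {1..int (card (fst ` D))} \<and> snd ` D = {1..int (card (snd ` D))}"

definition row_comp :: "diagram \<Rightarrow> nat list"
  where "row_comp D = map (\<lambda>a. card {b. (a, b) \<in> D}) [1..int (card (fst ` D))]"

definition col_comp :: "diagram \<Rightarrow> nat list"
  where "col_comp D = map (\<lambda>b. card {a. (a, b) \<in> D}) [1..int (card (snd ` D))]"

definition diagrams :: "nat list \<Rightarrow> diagram set"
  where "diagrams lam = {D. principal D \<and> row_comp D = lam}"

text \<open>
  The entry of a node in the row (column) filling is its rank in the row (column)
  reading order.
\<close>

definition t_row :: "diagram \<Rightarrow> int \<times> int \<Rightarrow> nat"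
  where "t_row D = (\<lambda>(a, b). card {(a', b') \<in> D. a' < a \<or> a' = a \<and> b' \<le> b})"

definition t_col :: "diagram \<Rightarrow> int \<times> int \<Rightarrow> nat"
  where "t_col D = (\<lambda>(a, b). card {(a', b') \<in> D. b' < b \<or> b' = b \<and> a' \<le> a})"

text \<open>The permutation taking \<open>t_row D d\<close> to \<open>t_col D d\<close> for every node \<open>d\<close>.\<close>

definition w_diag :: "diagram \<Rightarrow> nat \<Rightarrow> nat"
  where "w_diag D i =
    (if i \<in> {1..card D} then t_col D (the_inv_into D (t_row D) i) else i)"

definition young_diagram :: "nat list \<Rightarrow> diagram"
  where "young_diagram nu =
    {(a, b). 1 \<le> a \<and> a \<le> int (length nu) \<and> 1 \<le> b \<and> b \<le> int (nu ! nat (a - 1))}"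

definition special :: "diagram \<Rightarrow> bool"
  where "special D \<longleftrightarrow> (\<exists>nu f g. is_partition nu \<and>
    f permutes fst ` young_diagram nu \<and> g permutes snd ` young_diagram nu \<and>
    D = map_prod f g ` young_diagram nu)"


section \<open>The sets of the theorem\<close>

definition Z :: "nat list \<Rightarrow> (nat \<Rightarrow> nat) set"
  where "Z lam = {e \<in> X_J lam.
    right_cell_equiv (sum_list lam) (longest_J lam \<Zsemi> e) (longest_J lam)}"

definition Z_s :: "nat list \<Rightarrow> (nat \<Rightarrow> nat) set"
  where "Z_s lam = {e \<in> Z lam. \<exists>D \<in> diagrams lam. special D \<and> e = w_diag D}"

definition Y :: "nat list \<Rightarrow> (nat \<Rightarrow> nat) set"
  where "Y lam = {x \<in> Z lam. \<not> (\<exists>y \<in> Z lam. y \<noteq> x \<and> is_prefix (sum_list lam) x y)}"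

definition Y_s :: "nat list \<Rightarrow> (nat \<Rightarrow> nat) set"
  where "Y_s lam = Y lam \<inter> Z_s lam"

end

theory Submission
  imports Defs
begin

text \<open>
  Write \<open>\<lambda> = (1\<^sup>p, m, 1\<^sup>q)\<close>, where \<open>p, q \<ge> 1\<close>. The pairs of positions inverted by \<open>x\<inverse>y\<close> correspond to
  those inverted by exactly one of \<open>x\<close> and \<open>y\<close>, so \<open>x\<close> is a prefix of \<open>y\<close> iff every pair inverted
  by \<open>x\<close> is inverted by \<open>y\<close>. The row-form of \<open>w\<^sub>J e\<close>, for \<open>e\<close> in \<open>X_J \<lambda>\<close>, is a word \<open>a d b\<close> with \<open>d\<close>
  decreasing of length \<open>m\<close>; it has the recording tableau of \<open>w\<^sub>J\<close> iff \<open>a\<close> and \<open>b\<close> increase and some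
  entry \<open>d\<^sub>i\<close> lies above all of \<open>a\<close> and below all of \<open>b\<close>. For a fixed such \<open>i\<close> there is a largest
  possible set of inversions. It is attained by the permutation of the diagram in which a full
  row of length \<open>m\<close> crosses a full \<open>i\<close>-th column, and these \<open>m\<close> inversion sets are pairwise
  incomparable because \<open>p, q \<ge> 1\<close>. The crosses are exactly the diagrams with row-composition \<open>\<lambda>\<close>
  that have \<open>m\<close> columns, one of them of length \<open>p + q + 1\<close>.
\<close>

section \<open>Inversions and the weak order\<close>

definition inversions :: "(nat \<Rightarrow> nat) \<Rightarrow> (nat \<times> nat) set"
  where "inversions w = {(i, j). i < j \<and> w j < w i}"

lemma in_inversions [simp]: "(i, j) \<in> inversions w \<longleftrightarrow> i < j \<and> w j < w i"
  by (simp add: inversions_def)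

lemma inversions_subset:
  assumes "w permutes {a..b}"
  shows "inversions w \<subseteq> {a..b} \<times> {a..b}"
proof -
  have "i \<in> {a..b} \<and> j \<in> {a..b}" if "i < j" "w j < w i" for i j
    using that permutes_not_in[OF assms, of i] permutes_not_in[OF assms, of j]
      permutes_in_image[OF assms, of i] permutes_in_image[OF assms, of j]
    by (cases "i \<in> {a..b}"; cases "j \<in> {a..b}") auto
  then show ?thesis by (auto simp: inversions_def)
qed

lemma finite_inversions:
  assumes "w permutes {a..b}" shows "finite (inversions w)"
  using inversions_subset[OF assms] by (rule finite_subset) simp

text \<open>The element \<open>inv' x \<Zsemi> y\<close> sends the values \<open>x s\<close>,
  \<open>x t\<close> to \<open>y s\<close>, \<open>y t\<close>, so it inverts them exactly when
  \<open>x\<close> and \<open>y\<close> order the positions \<open>s\<close>, \<open>t\<close>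
  oppositely. Putting the two values in increasing order gives the bijection.\<close>

lemma card_inversions_quotient:
  assumes x: "bij x" and y: "inj y"
  shows "card (inversions (inv' x \<Zsemi> y)) = card (sym_diff (inversions x) (inversions y))"
proof -
  let ?f = "\<lambda>(s, t). if x s < x t then (x s, x t) else (x t, x s)"
  have inj_x: "inj x" and surj_x: "surj x" using x by (auto simp: bij_def)
  have ix: "inv' x (x s) = s" for s using inj_x by simp
  have "?f ` sym_diff (inversions x) (inversions y) = inversions (inv' x \<Zsemi> y)"
  proof (intro equalityI subrelI)
    fix u v assume "(u, v) \<in> ?f ` sym_diff (inversions x) (inversions y)"
    then obtain d where d: "d \<in> sym_diff (inversions x) (inversions y)" "(u, v) = ?f d"
      by (rule imageE)
    obtain s t where "d = (s, t)" by (cases d)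
    note d = d[unfolded this]
    have st: "s < t" "(x t < x s) \<noteq> (y t < y s)" using d(1) by auto
    have uv: "(u, v) = ?f (s, t)" using d(2) .
    have ne: "x s \<noteq> x t" "y s \<noteq> y t" using inj_x y st(1) by (simp_all add: inj_eq)
    show "(u, v) \<in> inversions (inv' x \<Zsemi> y)"
    proof (cases "x s < x t")
      case True
      then have "y t < y s" "u = x s" "v = x t" using st uv by simp_all
      then show ?thesis using True by (simp add: rmult_def ix)
    next
      case False
      then have "y s < y t" "u = x t" "v = x s" using st uv ne by simp_all
      then show ?thesis using False ne by (simp add: rmult_def ix)
    qed
  next
    fix u v assume uv: "(u, v) \<in> inversions (inv' x \<Zsemi> y)"
    obtain s t where [simp]: "u = x s" "v = x t" using surj_x by (meson surjD)
    have lt: "x s < x t" "y t < y s" using uv by (auto simp: rmult_def ix)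
    then have "s \<noteq> t" by auto
    then consider "s < t" | "t < s" by linarith
    then show "(u, v) \<in> ?f ` sym_diff (inversions x) (inversions y)"
    proof cases
      case 1
      then show ?thesis using lt by (intro image_eqI[of _ _ "(s, t)"]) auto
    next
      case 2
      then show ?thesis using lt by (intro image_eqI[of _ _ "(t, s)"]) auto
    qed
  qed
  then have img: "card (inversions (inv' x \<Zsemi> y))
    = card (?f ` sym_diff (inversions x) (inversions y))" by simp
  \<comment> \<open>The left inverse pulls both values back along \<open>x\<close> and restores the
    increasing order of the positions.\<close>
  have "inj_on ?f (sym_diff (inversions x) (inversions y))"
  proof (rule inj_on_inverseI)
    fix d assume "d \<in> sym_diff (inversions x) (inversions y)"
    moreover obtain s t where "d = (s, t)" by (cases d)
    ultimately show "(\<lambda>(u, v). (min (inv' x u) (inv' x v), max (inv' x u) (inv' x v))) (?f d) = d"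
      by (auto simp: ix)
  qed
  then show ?thesis unfolding img by (rule card_image)
qed

section \<open>Simple reflections, reduced words and length\<close>

lemma inversions_simple_refl: "inversions (simple_refl i) = {(i, Suc i)}"
  by (auto simp: inversions_def simple_refl_def transpose_def split: if_splits)

lemma simple_refl_permutes: "i \<in> {a..<b} \<Longrightarrow> simple_refl i permutes {a..b}"
  unfolding simple_refl_def by (rule permutes_swap_id) auto

lemma simple_refl_rmult: "simple_refl i \<Zsemi> (simple_refl i \<Zsemi> w) = w"
  by (simp add: rmult_def simple_refl_def comp_assoc)

text \<open>A simple reflection is its own inverse and inverts a single pair. The symmetric
  difference removes that pair at a descent of \<open>w\<close> and adds it otherwise.\<close>

lemma card_inversions_simple_refl:
  assumes "inj w"
  shows "card (inversions (simple_refl i \<Zsemi> w)) = card (sym_diff {(i, Suc i)} (inversions w))"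
proof -
  have "inv' (simple_refl i) = simple_refl i" "bij (simple_refl i)"
    by (simp_all add: simple_refl_def)
  then show ?thesis
    using card_inversions_quotient[of "simple_refl i" w] assms by (simp add: inversions_simple_refl)
qed

lemma word_prod_simps [simp]:
  "word_prod [] = id" "word_prod (i # is) = simple_refl i \<Zsemi> word_prod is"
  by (simp_all add: word_prod_def)

lemma word_prod_permutes: "set is \<subseteq> {a..<b} \<Longrightarrow> word_prod is permutes {a..b}"
proof (induction "is")
  case (Cons i "is")
  then have "i \<in> {a..<b}" "set is \<subseteq> {a..<b}" by simp_all
  then show ?case
    unfolding word_prod_simps rmult_def by (intro permutes_compose simple_refl_permutes Cons.IH)
qed (simp add: permutes_id)

text \<open>Each letter adds at most one inversion. This is the lower bound for the length of a
  word.\<close>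

lemma card_inversions_word_prod: "card (inversions (word_prod is)) \<le> length is"
proof (induction "is")
  case Nil
  have "inversions id = {}" by (auto simp: inversions_def)
  then show ?case by (simp only: word_prod_simps card.empty)
next
  case (Cons i "is")
  \<comment> \<open>The letters are arbitrary, so an interval containing all of them is chosen to
    make the inversion set finite.\<close>
  have "set is \<subseteq> {0..<Suc (Max (set is))}" by (auto simp: less_Suc_eq_le)
  note perm = word_prod_permutes[OF this]
  note fin = finite_inversions[OF perm] and inj = permutes_inj[OF perm]
  have "card (sym_diff {(i, Suc i)} (inversions (word_prod is)))
    \<le> card (insert (i, Suc i) (inversions (word_prod is)))"
    using fin by (intro card_mono) auto
  also have "\<dots> \<le> Suc (card (inversions (word_prod is)))" by (rule card_insert_le_m1) simp_all
  finally show ?case using Cons card_inversions_simple_refl[OF inj] by simp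
qed

text \<open>The inverse is increasing as well, and an increasing self-map of the naturals never goes
  below its argument; applied to both maps this leaves only the identity.\<close>

lemma strict_mono_permutes_id:
  fixes w :: "nat \<Rightarrow> nat"
  assumes "w permutes S" "strict_mono w"
  shows "w = id"
proof
  fix i
  have "strict_mono (inv' w)"
  proof (rule strict_monoI)
    fix i j :: nat assume "i < j"
    then have "w (inv' w i) < w (inv' w j)" by (simp only: permutes_inverses[OF assms(1)])
    then show "inv' w i < inv' w j" by (rule strict_mono_less[OF assms(2), THEN iffD1])
  qed
  then have "w i \<le> inv' w (w i)" by (rule strict_mono_imp_increasing)
  then have "w i \<le> i" using permutes_inverses[OF assms(1)] by simp
  moreover have "i \<le> w i" using assms(2) by (rule strict_mono_imp_increasing)
  ultimately show "w i = id i" by simp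
qed

lemma ex_descent:
  assumes "w permutes S" "w \<noteq> id"
  obtains i where "(i, Suc i) \<in> inversions w"
proof -
  have "\<not> strict_mono w" using strict_mono_permutes_id[OF assms(1)] assms(2) by blast
  then obtain i where "\<not> w i < w (Suc i)" by (auto simp: strict_mono_Suc_iff)
  moreover have "w i \<noteq> w (Suc i)" using permutes_inj[OF assms(1)] by (simp add: inj_eq)
  ultimately show ?thesis using that[of i] by simp
qed

text \<open>Splitting off a descent on the left removes exactly one inversion. The interval is
  arbitrary so that the lemma covers both the full group and the subgroup of a block.\<close>

lemma ex_reduced_word:
  assumes "w permutes {a..b}"
  shows "\<exists>is. set is \<subseteq> {a..<b} \<and> length is = card (inversions w) \<and> word_prod is = w"
  using assms
proof (induction "card (inversions w)" arbitrary: w)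
  case 0
  then have "inversions w = {}" using finite_inversions[OF 0(2)] by simp
  then have "w = id" using ex_descent[OF 0(2)] by blast
  then show ?case using 0(1) by (intro exI[of _ "[]"]) simp
next
  case (Suc k)
  have "inversions id = {}" by (auto simp: inversions_def)
  then have "w \<noteq> id" using Suc(2) by (metis card.empty nat.distinct(1))
  then obtain i where i: "(i, Suc i) \<in> inversions w" using ex_descent[OF Suc(3)] by blast
  have ab: "i \<in> {a..<b}" using subsetD[OF inversions_subset[OF Suc(3)] i] by simp
  define v where "v = simple_refl i \<Zsemi> w"
  have v: "v permutes {a..b}"
    unfolding v_def rmult_def by (intro permutes_compose simple_refl_permutes ab Suc(3))
  have "sym_diff {(i, Suc i)} (inversions w) = inversions w - {(i, Suc i)}" using i by auto
  then have "card (inversions v) = k"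
    using card_inversions_simple_refl[OF permutes_inj[OF Suc(3)]] i Suc(2)
    by (simp add: v_def del: in_inversions)
  then obtain "is" where "set is \<subseteq> {a..<b}" "length is = k" "word_prod is = v"
    using Suc(1)[OF _ v] by blast
  then have "set (i # is) \<subseteq> {a..<b}" "length (i # is) = card (inversions w)"
    "word_prod (i # is) = w"
    using ab Suc(2) simple_refl_rmult[of i w] by (simp_all add: v_def)
  then show ?case by blast
qed

lemma cox_length_eq:
  assumes "w permutes {1..n}"
  shows "cox_length n w = card (inversions w)"
  unfolding cox_length_def
proof (rule Least_equality)
  show "\<exists>is. set is \<subseteq> {1..<n} \<and> length is = card (inversions w) \<and> word_prod is = w"
    using ex_reduced_word[OF assms] .
qed (use card_inversions_word_prod in auto)

text \<open>With \<open>?X\<close> and \<open>?Y\<close> the inversion sets, additivity of lengths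
  reads \<open>card ?Y = card ?X + card (?X - ?Y) + card (?Y - ?X)\<close>. Since always
  \<open>card ?Y + card (?X - ?Y) = card ?X + card (?Y - ?X)\<close>, this forces
  \<open>?X - ?Y\<close> to be empty.\<close>

lemma is_prefix_iff:
  assumes "x permutes {1..n}" "y permutes {1..n}"
  shows "is_prefix n x y \<longleftrightarrow> inversions x \<subseteq> inversions y"
proof -
  let ?X = "inversions x" and ?Y = "inversions y"
  have fin: "finite ?X" "finite ?Y" using assms finite_inversions by auto
  have "inv' x \<Zsemi> y permutes {1..n}"
    unfolding rmult_def using assms by (intro permutes_compose permutes_inv)
  then have "cox_length n (inv' x \<Zsemi> y) = card (sym_diff ?X ?Y)"
    using assms by (simp add: cox_length_eq card_inversions_quotient permutes_bij permutes_inj)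
  also have "\<dots> = card (?X - ?Y) + card (?Y - ?X)" using fin by (intro card_Un_disjoint) auto
  finally have "is_prefix n x y \<longleftrightarrow> card ?Y = card ?X + card (?X - ?Y) + card (?Y - ?X)"
    using assms by (simp add: is_prefix_def cox_length_eq add.assoc)
  moreover have "card ?Y + card (?X - ?Y) = card ?X + card (?Y - ?X)"
    using fin card_Un_disjoint[of ?Y "?X - ?Y"] card_Un_disjoint[of ?X "?Y - ?X"]
    by (simp add: Un_commute)
  ultimately have "is_prefix n x y \<longleftrightarrow> card (?X - ?Y) = 0" by linarith
  then show ?thesis using fin by auto
qed

text \<open>The quotient of \<open>x\<close> and \<open>y\<close> has no inversions, hence no
  descent, hence is the identity.\<close>

lemma inversions_inject:
  assumes "x permutes {a..b}" "y permutes {a..b}" "inversions x = inversions y"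
  shows "x = y"
proof -
  have v: "inv' x \<Zsemi> y permutes {a..b}"
    unfolding rmult_def using assms by (intro permutes_compose permutes_inv)
  have "inv' x \<Zsemi> y = id"
  proof (rule ccontr)
    assume "inv' x \<Zsemi> y \<noteq> id"
    then have "inversions (inv' x \<Zsemi> y) \<noteq> {}" using ex_descent[OF v] by blast
    then show False
      using finite_inversions[OF v] card_inversions_quotient[of x y] assms
      by (simp add: permutes_bij permutes_inj)
  qed
  then have "y \<circ> inv' x \<circ> x = x" by (simp add: rmult_def)
  then show ?thesis using permutes_inv_o(2)[OF assms(1)] by (simp add: comp_assoc)
qed


section \<open>Recording tableaux as sequences of row indices\<close>

fun tab_inserts :: "tableau \<Rightarrow> nat list \<Rightarrow> tableau" where
  "tab_inserts T [] = T"
| "tab_inserts T (x # xs) = tab_inserts (fst (tab_insert x T)) xs"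

fun new_rows :: "tableau \<Rightarrow> nat list \<Rightarrow> nat list" where
  "new_rows T [] = []"
| "new_rows T (x # xs) = snd (tab_insert x T) # new_rows (fst (tab_insert x T)) xs"

fun record_rows :: "nat \<Rightarrow> tableau \<Rightarrow> nat list \<Rightarrow> tableau" where
  "record_rows i Q [] = Q"
| "record_rows i Q (k # ks) = record_rows (Suc i) (add_to_row k i Q) ks"

text \<open>The argument \<open>l\<close> is the current number of rows. The bound matters because
  \<open>add_to_row\<close> opens just one new row for any index past the end, so larger indices
  could not be told apart.\<close>

fun row_growth :: "nat \<Rightarrow> nat list \<Rightarrow> bool" where
  "row_growth l [] = True"
| "row_growth l (k # ks) = (k \<le> l \<and> row_growth (max l (Suc k)) ks)"

lemma new_rows_append: "new_rows T (xs @ ys) = new_rows T xs @ new_rows (tab_inserts T xs) ys"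
  by (induction xs arbitrary: T) auto

lemma length_new_rows [simp]: "length (new_rows T xs) = length xs"
  by (induction xs arbitrary: T) auto

lemma foldl_rs_step:
  "foldl rs_step (P, Q) (enumerate i xs) = (tab_inserts P xs, record_rows i Q (new_rows P xs))"
  by (induction xs arbitrary: P Q i) (auto simp: case_prod_unfold Let_def)

lemma tab_insert_length:
  "snd (tab_insert x T) \<le> length T \<and>
   length (fst (tab_insert x T)) = max (length T) (Suc (snd (tab_insert x T)))"
proof (induction T arbitrary: x)
  case (Cons R T)
  obtain R' b where "row_insert x R = (R', b)" by (cases "row_insert x R")
  then show ?case using Cons.IH[of "the b"] by (cases b) (auto simp: case_prod_unfold Let_def)
qed simp

lemma row_growth_new_rows: "row_growth (length T) (new_rows T xs)"
proof (induction xs arbitrary: T)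
  case (Cons x xs)
  show ?case using Cons[of "fst (tab_insert x T)"] tab_insert_length[of x T] by simp
qed simp

definition has_entry :: "tableau \<Rightarrow> nat \<Rightarrow> nat \<Rightarrow> bool"
  where "has_entry Q j i \<longleftrightarrow> j < length Q \<and> i \<in> set (Q ! j)"

lemma has_entry_Nil: "\<not> has_entry [] j i"
  by (simp add: has_entry_def)

lemma has_entry_Cons: "has_entry (R # Q) j i \<longleftrightarrow> (if j = 0 then i \<in> set R else has_entry Q (j - 1) i)"
  by (auto simp: has_entry_def nth_Cons split: nat.splits)

lemma add_to_row_growth:
  assumes "k \<le> length Q"
  shows "length (add_to_row k i Q) = max (length Q) (Suc k)"
    and "has_entry (add_to_row k i Q) j i' \<longleftrightarrow> has_entry Q j i' \<or> i' = i \<and> j = k"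
proof -
  show "length (add_to_row k i Q) = max (length Q) (Suc k)"
    using assms by (induction k i Q rule: add_to_row.induct) simp_all
  show "has_entry (add_to_row k i Q) j i' \<longleftrightarrow> has_entry Q j i' \<or> i' = i \<and> j = k"
    using assms
  proof (induction k i Q arbitrary: j rule: add_to_row.induct)
    case (3 k i R T)
    then show ?case by (cases j) (simp_all add: has_entry_Cons)
  qed (auto simp: has_entry_Nil has_entry_Cons)
qed

lemma has_entry_record_rows:
  assumes "row_growth (length Q) ks"
  shows "has_entry (record_rows i Q ks) j i' \<longleftrightarrow>
    has_entry Q j i' \<or> i \<le> i' \<and> i' < i + length ks \<and> ks ! (i' - i) = j"
  using assms
proof (induction ks arbitrary: i Q)
  case (Cons k ks)
  have k: "k \<le> length Q" using Cons.prems by simp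
  have "has_entry (record_rows i Q (k # ks)) j i' \<longleftrightarrow>
    has_entry (add_to_row k i Q) j i' \<or>
    Suc i \<le> i' \<and> i' < Suc i + length ks \<and> ks ! (i' - Suc i) = j"
    using Cons.prems Cons.IH[of "add_to_row k i Q" "Suc i"] add_to_row_growth(1)[OF k, of i] by simp
  also have "\<dots> \<longleftrightarrow> has_entry Q j i' \<or>
    i \<le> i' \<and> i' < i + length (k # ks) \<and> (k # ks) ! (i' - i) = j"
    by (cases "i' = i") (auto simp: add_to_row_growth(2)[OF k] nth_Cons' not_le)
  finally show ?case .
qed auto

text \<open>The entry \<open>i + j\<close> stands in the row named by the \<open>j\<close>-th index,
  so the whole sequence can be read off the tableau.\<close>

lemma record_rows_inject:
  assumes "row_growth 0 ks" "row_growth 0 ks'" "length ks = length ks'"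
    and "record_rows i [] ks = record_rows i [] ks'"
  shows "ks = ks'"
proof (rule nth_equalityI[OF assms(3)])
  fix j assume "j < length ks"
  then have "has_entry (record_rows i [] ks) (ks ! j) (i + j)"
    using assms(1) by (simp add: has_entry_record_rows)
  then show "ks ! j = ks' ! j"
    unfolding assms(4) using assms(2) by (simp add: has_entry_record_rows has_entry_Nil)
qed

text \<open>The recording tableau and the sequence of rows that receive the new boxes determine each
  other.\<close>

lemma right_cell_equiv_iff:
  "right_cell_equiv n x y \<longleftrightarrow> new_rows [] (row_form n x) = new_rows [] (row_form n y)"
  using record_rows_inject[of "new_rows [] (row_form n x)" "new_rows [] (row_form n y)" 1]
    row_growth_new_rows[of "[]"]
  by (auto simp: right_cell_equiv_def recording_tableau_def RS_def foldl_rs_step row_form_def)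


section \<open>Insertion into hook-shaped tableaux\<close>

abbreviation column :: "nat list \<Rightarrow> tableau"
  where "column \<equiv> map (\<lambda>c. [c])"

lemma row_insert_append: "\<forall>u\<in>set us. u \<le> x \<Longrightarrow> row_insert x us = (us @ [x], None)"
  by (induction us) auto

lemma row_insert_bump:
  "\<forall>u\<in>set us. u \<le> x \<Longrightarrow> x < y \<Longrightarrow> row_insert x (us @ y # vs) = (us @ x # vs, Some y)"
  by (induction us) auto

text \<open>The new value bumps the top entry, which is again smaller than everything below it; the
  column moves down by one and the new box appears at its bottom.\<close>

lemma tab_insert_column:
  "sorted_wrt (<) (y # cs) \<Longrightarrow> tab_insert y (column cs) = (column (y # cs), length cs)"
  by (induction cs arbitrary: y) auto

text \<open>A value that exceeds the first row is appended to it; any other value bumps an entry, so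
  that the new box falls in a lower row.\<close>

lemma new_rows_replicate_0:
  assumes "sorted_wrt (<) R" "distinct (R @ bs)"
  shows "new_rows (R # T) bs = replicate (length bs) 0 \<longleftrightarrow> sorted_wrt (<) (R @ bs)"
    and "sorted_wrt (<) (R @ bs) \<Longrightarrow> tab_inserts (R # T) bs = (R @ bs) # T"
proof -
  have "(new_rows (R # T) bs = replicate (length bs) 0 \<longleftrightarrow> sorted_wrt (<) (R @ bs)) \<and>
    (sorted_wrt (<) (R @ bs) \<longrightarrow> tab_inserts (R # T) bs = (R @ bs) # T)"
    using assms
  proof (induction bs arbitrary: R)
    case (Cons b bs)
    show ?case
    proof (cases "\<forall>u\<in>set R. u \<le> b")
      case True
      then have "\<forall>u\<in>set R. u < b" using Cons.prems by (auto simp: order.order_iff_strict)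
      then have "sorted_wrt (<) (R @ [b])" using Cons.prems by (simp add: sorted_wrt_append)
      then show ?thesis
        using Cons.IH[of "R @ [b]"] Cons.prems row_insert_append[OF True] by simp
    next
      case False
      then have "\<exists>y\<in>set R. b < y" by (simp add: not_le)
      from split_list_first_prop[OF this] obtain us y vs
        where R: "R = us @ y # vs" "b < y" "\<forall>u\<in>set us. \<not> b < u" by auto
      then have "snd (tab_insert b (R # T)) \<noteq> 0"
        using row_insert_bump[of us b y vs] by (simp add: not_less case_prod_unfold Let_def)
      moreover have "\<not> sorted_wrt (<) (R @ b # bs)"
        using R by (auto simp: sorted_wrt_append)
      ultimately show ?thesis by simp
    qed
  qed simp
  then show "new_rows (R # T) bs = replicate (length bs) 0 \<longleftrightarrow> sorted_wrt (<) (R @ bs)"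
    "sorted_wrt (<) (R @ bs) \<Longrightarrow> tab_inserts (R # T) bs = (R @ bs) # T" by auto
qed

text \<open>
  The first row is \<open>B @ [h]\<close>, the value \<open>z\<close> was inserted last, and \<open>h\<close> stays the least
  value above \<open>l\<close> that has been inserted. The entry bumped from the first row is at most
  \<open>z\<close>, hence smaller than the whole column, which it pushes down by one.
\<close>

lemma insert_decreasing:
  assumes "sorted_wrt (<) (z # cs)" "z \<in> set (B @ [h])" "min z l \<in> set B" "\<forall>b\<in>set B. b \<le> l"
    and "sorted_wrt (<) B" "l < h" "sorted_wrt (>) (z # ds)" "l \<notin> set ds"
    and "set ds \<inter> set B = {}"
  shows "new_rows ((B @ [h]) # column cs) ds = [Suc (length cs)..<Suc (length cs) + length ds] \<and>
    (\<exists>B' h' cs'. tab_inserts ((B @ [h]) # column cs) ds = (B' @ [h']) # column cs' \<and>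
      sorted_wrt (<) (B' @ [h']) \<and> set (B' @ [h']) \<subseteq> set (B @ [h]) \<union> set ds \<and>
      l < h' \<and> h' \<in> insert h (set ds) \<and> h' \<le> h \<and> (\<forall>d\<in>set ds. l < d \<longrightarrow> h' \<le> d))"
  using assms
proof (induction ds arbitrary: B h cs z)
  case Nil
  have "sorted_wrt (<) (B @ [h])" using Nil by (fastforce simp: sorted_wrt_append)
  then show ?case using Nil by auto
next
  case (Cons d ds)
  have d: "d < z" "d \<noteq> l" "d \<notin> set B" using Cons.prems by auto
  have ds: "sorted_wrt (>) (d # ds)" "l \<notin> set ds" "d \<notin> set ds" using Cons.prems by auto
  show ?case
  proof (cases "l < d")
    case True
    \<comment> \<open>The value \<open>z\<close> is still in the first row and exceeds
      \<open>d\<close>, while \<open>h\<close> is the only entry there above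
      \<open>l\<close>.\<close>
    then have z: "z = h" using Cons.prems(2,4) d by auto
    then have lB: "l \<in> set B" using Cons.prems(3,6) by (simp add: min_def split: if_splits)
    have "\<forall>u\<in>set B. u \<le> d" using Cons.prems(4) True by auto
    then have ins: "tab_insert d ((B @ [h]) # column cs) =
      ((B @ [d]) # column (h # cs), Suc (length cs))"
      using Cons.prems(1) d row_insert_bump[of B d h "[]"] tab_insert_column[of h cs] z by simp
    have "new_rows ((B @ [d]) # column (h # cs)) ds =
        [Suc (length (h # cs))..<Suc (length (h # cs)) + length ds] \<and>
      (\<exists>B' h' cs'. tab_inserts ((B @ [d]) # column (h # cs)) ds = (B' @ [h']) # column cs' \<and>
        sorted_wrt (<) (B' @ [h']) \<and> set (B' @ [h']) \<subseteq> set (B @ [d]) \<union> set ds \<and>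
        l < h' \<and> h' \<in> insert d (set ds) \<and> h' \<le> d \<and> (\<forall>d\<in>set ds. l < d \<longrightarrow> h' \<le> d))"
    proof (rule Cons.IH[of d])
      show "sorted_wrt (<) (d # h # cs)" using Cons.prems(1) d z by auto
      show "min d l \<in> set B" using True lB by (simp add: min_def)
    qed (use Cons.prems True ds in auto)
    then show ?thesis
      using ins d z by (simp add: upt_conv_Cons del: upt_Suc list.map) (elim conjE exE, intro exI conjI, auto)
  next
    case False
    then have dl: "d < l" using d by auto
    \<comment> \<open>Both \<open>z\<close> and \<open>l\<close> exceed \<open>d\<close>, so the
      entry \<open>min z l\<close> of \<open>B\<close> does. The bump therefore happens inside
      \<open>B\<close> and leaves \<open>h\<close> in place.\<close>
    have "\<exists>y\<in>set B. d < y" using Cons.prems(3) d(1) dl by (metis min_less_iff_conj)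
    from split_list_first_prop[OF this] obtain us y vs
      where B: "B = us @ y # vs" "d < y" "\<forall>u\<in>set us. \<not> d < u" by auto
    have us: "\<forall>u\<in>set us. u \<le> d" using B(3) by (simp add: not_less)
    have us': "\<forall>u\<in>set us. u < d" using us d(3) B(1) by (auto simp: order.order_iff_strict)
    \<comment> \<open>The row increases and contains \<open>z\<close>, and \<open>y\<close> is its
      first entry above \<open>d\<close>.\<close>
    have "y \<le> z" using Cons.prems(2,4,5,6) B d(1) by (auto simp: sorted_wrt_append)
    then have ycs: "sorted_wrt (<) (y # cs)" using Cons.prems(1) by auto
    have ins: "tab_insert d ((B @ [h]) # column cs) =
      (((us @ d # vs) @ [h]) # column (y # cs), Suc (length cs))"
      using row_insert_bump[OF us B(2), of "vs @ [h]"] tab_insert_column[OF ycs] B(1) by simp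
    have "new_rows (((us @ d # vs) @ [h]) # column (y # cs)) ds =
        [Suc (length (y # cs))..<Suc (length (y # cs)) + length ds] \<and>
      (\<exists>B' h' cs'. tab_inserts (((us @ d # vs) @ [h]) # column (y # cs)) ds = (B' @ [h']) # column cs' \<and>
        sorted_wrt (<) (B' @ [h']) \<and> set (B' @ [h']) \<subseteq> set ((us @ d # vs) @ [h]) \<union> set ds \<and>
        l < h' \<and> h' \<in> insert h (set ds) \<and> h' \<le> h \<and> (\<forall>d\<in>set ds. l < d \<longrightarrow> h' \<le> d))"
    proof (rule Cons.IH[of d])
      show "sorted_wrt (<) (d # y # cs)" using ycs B(2) by auto
      show "min d l \<in> set (us @ d # vs)" using dl by (simp add: min_def)
      show "sorted_wrt (<) (us @ d # vs)"
        using Cons.prems(5) B us' by (auto simp: sorted_wrt_append)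
      show "\<forall>b\<in>set (us @ d # vs). b \<le> l" using Cons.prems(4) B dl by auto
    qed (use Cons.prems B ds in auto)
    then show ?thesis
      using ins B dl by (simp add: upt_conv_Cons del: upt_Suc list.map) (elim conjE exE, intro exI conjI, auto)
  qed
qed

text \<open>The insertion has three stages. First \<open>as\<close> and the largest entry of
  \<open>ds\<close> must form an increasing row. The rest of \<open>ds\<close> then always lengthens
  the first column. By then the first row ends in the least entry of \<open>ds\<close> above
  \<open>last as\<close>, and \<open>bs\<close> extends this row iff it increases and starts above
  that entry.\<close>

lemma new_rows_hook:
  assumes "distinct (as @ ds @ bs)" "as \<noteq> []" "ds \<noteq> []" "bs \<noteq> []" "sorted_wrt (>) ds"
  shows "new_rows [] (as @ ds @ bs) =
      replicate (Suc (length as)) 0 @ [1..<length ds] @ replicate (length bs) 0 \<longleftrightarrow>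
    sorted_wrt (<) as \<and> sorted_wrt (<) bs \<and> (\<exists>d\<in>set ds. last as < d \<and> d < hd bs)"
    (is "?L \<longleftrightarrow> ?R")
proof -
  obtain h ds' where ds: "ds = h # ds'" using assms(3) by (auto simp: neq_Nil_conv)
  let ?w = "as @ [h]" and ?T = "tab_inserts [] (as @ [h])"
  have le_last: "\<forall>a\<in>set as. a \<le> last as" if "sorted_wrt (<) as"
    using that by (induction as rule: rev_induct) (auto simp: sorted_wrt_append)
  have hd_h: "\<forall>d\<in>set ds. d \<le> h" using assms(5) ds by auto
  \<comment> \<open>Starting from one empty row changes nothing for a nonempty word and provides the
    row that \<open>new_rows_replicate_0\<close> speaks of.\<close>
  have "new_rows [] ?w = new_rows [[]] ?w" "?T = tab_inserts [[]] ?w"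
    using assms(2) by (cases as; simp)+
  moreover have "distinct ([] @ ?w)" using assms(1) ds by simp
  ultimately have row1: "new_rows [] ?w = replicate (length ?w) 0 \<longleftrightarrow> sorted_wrt (<) ?w"
    and T: "sorted_wrt (<) ?w \<Longrightarrow> ?T = [?w]"
    using new_rows_replicate_0[of "[]" ?w "[]"] by simp_all
  have "new_rows [] (as @ ds @ bs) =
    new_rows [] ?w @ new_rows ?T ds' @ new_rows (tab_inserts ?T ds') bs"
    using new_rows_append[of "[]" ?w "ds' @ bs"] by (simp add: ds new_rows_append)
  then have L: "?L \<longleftrightarrow> sorted_wrt (<) ?w \<and> new_rows ?T ds' = [1..<length ds] \<and>
    new_rows (tab_inserts ?T ds') bs = replicate (length bs) 0"
    unfolding row1[symmetric] by (simp add: ds append_eq_append_conv del: upt_Suc replicate.simps)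
  show ?thesis
  proof (cases "sorted_wrt (<) ?w")
    case True
    have as: "sorted_wrt (<) as" "last as < h" using True assms(2) by (auto simp: sorted_wrt_append)
    note last_as = le_last[OF as(1)]
    have "new_rows ((as @ [h]) # column []) ds' =
        [Suc (length ([]::nat list))..<Suc (length ([]::nat list)) + length ds'] \<and>
      (\<exists>B' h' cs'. tab_inserts ((as @ [h]) # column []) ds' = (B' @ [h']) # column cs' \<and>
        sorted_wrt (<) (B' @ [h']) \<and> set (B' @ [h']) \<subseteq> set (as @ [h]) \<union> set ds' \<and>
        last as < h' \<and> h' \<in> insert h (set ds') \<and> h' \<le> h \<and>
        (\<forall>d\<in>set ds'. last as < d \<longrightarrow> h' \<le> d))"
    proof (rule insert_decreasing[of h])
      have "last as \<in> set as" using assms(2) by simp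
      then show "last as \<notin> set ds'" using assms(1) ds by auto
    qed (use as last_as assms ds in auto)
    then obtain B' h' cs' where B': "tab_inserts ?T ds' = (B' @ [h']) # column cs'"
      "sorted_wrt (<) (B' @ [h'])" "set (B' @ [h']) \<subseteq> set (as @ [h]) \<union> set ds'"
      "last as < h'" "h' \<in> insert h (set ds')" "h' \<le> h" "\<forall>d\<in>set ds'. last as < d \<longrightarrow> h' \<le> d"
      and mid: "new_rows ?T ds' = [1..<length ds]"
      using T[OF True] by (auto simp: ds)
    have "distinct (B' @ [h'])" using B'(2) strict_sorted_iff by blast
    moreover have "set (B' @ [h']) \<inter> set bs = {}" using B'(3) assms(1) ds by auto
    ultimately have "distinct ((B' @ [h']) @ bs)" using assms(1) by simp
    then have "?L \<longleftrightarrow> sorted_wrt (<) ((B' @ [h']) @ bs)"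
      using L True mid new_rows_replicate_0(1)[OF B'(2)] B'(1) by simp
    also have "\<dots> \<longleftrightarrow> sorted_wrt (<) bs \<and> h' < hd bs"
      using B'(2) assms(4) by (cases bs, simp, auto simp: sorted_wrt_append) (meson less_trans)
    also have "\<dots> \<longleftrightarrow> ?R"
      using as B' ds by auto
    finally show ?thesis .
  next
    case False
    \<comment> \<open>If \<open>as\<close> increases and some entry of \<open>ds\<close> exceeds
      \<open>last as\<close>, then so does the largest one, \<open>h\<close>, and \<open>?w\<close>
      increases.\<close>
    then have "\<not> ?R"
      using hd_h le_last by (fastforce simp: sorted_wrt_append)
    then show ?thesis using L False by blast
  qed
qed


section \<open>The parabolic subgroup of a hook composition\<close>

lemma simple_refl_inject: "simple_refl i = simple_refl j \<longleftrightarrow> i = j"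
proof
  assume "simple_refl i = simple_refl j"
  then have "inversions (simple_refl i) = inversions (simple_refl j)" by (rule arg_cong)
  then show "i = j" by (simp add: inversions_simple_refl)
qed simp

lemma ex_adjacent_descent:
  fixes e :: "nat \<Rightarrow> nat"
  assumes "i < j" "e j < e i" "inj e"
  obtains k where "i \<le> k" "k < j" "e (Suc k) < e k"
proof -
  have "\<exists>k. i \<le> k \<and> k < j \<and> e (Suc k) < e k"
  proof (rule ccontr)
    assume "\<not> ?thesis"
    then have step: "e k \<le> e (Suc k)" if "i \<le> k" "k < j" for k
      using that by (meson not_le)
    have "e i \<le> e (i + d)" if "i + d \<le> j" for d
      using that
    proof (induction d)
      case (Suc d)
      then show ?case using step[of "i + d"] by simp
    qed simp
    from this[of "j - i"] assms show False by simp
  qed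
  then show ?thesis using that by blast
qed

lemma sorted_wrt_map_upt:
  fixes f :: "nat \<Rightarrow> nat"
  shows "sorted_wrt (<) (map f [a..<b]) \<longleftrightarrow> (\<forall>i j. a \<le> i \<and> i < j \<and> j < b \<longrightarrow> f i < f j)"
proof (induction b)
  case (Suc b)
  then show ?case
    by (cases "a \<le> b") (auto simp: sorted_wrt_append less_Suc_eq)
qed simp

text \<open>The conditions on \<open>p\<close> and \<open>q\<close> express that neither the
  composition \<open>lam\<close> below nor its reverse is a partition.\<close>

locale hook_composition =
  fixes p m q :: nat
  assumes p: "p \<ge> 1" and m: "m \<ge> 2" and q: "q \<ge> 1"
begin

definition lam :: "nat list"
  where "lam = replicate p 1 @ m # replicate q 1"

abbreviation N :: nat
  where "N \<equiv> p + m + q"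

abbreviation block :: "nat set"
  where "block \<equiv> {Suc p..p + m}"

lemma sum_list_lam: "sum_list lam = N"
  by (simp add: lam_def sum_list_replicate)

lemma length_lam: "length lam = Suc (p + q)"
  by (simp add: lam_def)

lemma sum_list_take_lam:
  assumes "k < length lam"
  shows "sum_list (take k lam) = (if k \<le> p then k else k + m - 1)"
proof (cases "k \<le> p")
  case False
  then obtain d where "k = Suc (p + d)" by (metis add_Suc less_imp_Suc_add linorder_not_less)
  then show ?thesis using assms by (simp add: lam_def sum_list_replicate min_def)
qed (simp add: lam_def sum_list_replicate min_def)

lemma J_lam: "J lam = simple_refl ` {Suc p..<p + m}"
proof -
  have "(\<lambda>k. sum_list (take k lam)) ` {1..<length lam} =
    (\<lambda>k. if k \<le> p then k else k + m - 1) ` {1..<Suc (p + q)}"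
    by (intro image_cong sum_list_take_lam) (simp_all add: length_lam)
  also have "\<dots> = {1..p} \<union> {p + m..<N}" (is "?f ` ?A = ?B")
  proof (intro equalityI subsetI)
    fix x assume "x \<in> ?f ` ?A"
    then show "x \<in> ?B" using m by (auto split: if_splits)
  next
    fix x assume x: "x \<in> ?B"
    \<comment> \<open>Exactly \<open>Suc x - m\<close> parts lie before a cut \<open>x\<close>
      beyond the long part, which covers \<open>m\<close> positions by one part.\<close>
    then have "x = ?f (if x \<le> p then x else Suc x - m)" "(if x \<le> p then x else Suc x - m) \<in> ?A"
      using m by auto
    then show "x \<in> ?f ` ?A" by (rule image_eqI)
  qed
  finally have "(\<lambda>k. sum_list (take k lam)) ` {1..<length lam} = {1..p} \<union> {p + m..<N}" .
  then have "(\<lambda>k. simple_refl (sum_list (take k lam))) ` {1..<length lam} =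
    simple_refl ` ({1..p} \<union> {p + m..<N})" by (metis image_image)
  moreover have "inj simple_refl" by (simp add: inj_def simple_refl_inject)
  ultimately have "J lam = simple_refl ` ({1..<N} - ({1..p} \<union> {p + m..<N}))"
    by (simp add: J_def sum_list_lam image_set_diff)
  moreover have "{1..<N} - ({1..p} \<union> {p + m..<N}) = {Suc p..<p + m}" by auto
  ultimately show ?thesis by simp
qed

lemma permutes_block: "u permutes block \<Longrightarrow> u permutes {1..N}"
  by (erule permutes_subset) auto

text \<open>The generators move only points of the block, and so do their products. Conversely,
  \<open>ex_reduced_word\<close> on the block writes each of its permutations in these
  generators.\<close>

lemma W_J_lam: "W_J lam = {u. u permutes block}"
proof (intro equalityI subsetI)
  fix u assume "u \<in> W_J lam"
  then have "u \<in> generate (sym_group N) (simple_refl ` {Suc p..<p + m})"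
    by (simp add: W_J_def J_lam sum_list_lam)
  then have "u permutes block"
  proof (induction rule: generate.induct)
    case one
    then show ?case by (simp only: sym_group_one permutes_id)
  next
    case (incl h)
    then show ?case by (auto intro: simple_refl_permutes)
  next
    case (inv h)
    then have h: "h permutes block" by (auto intro: simple_refl_permutes)
    then have "h \<in> carrier (sym_group N)" using permutes_block by (simp add: sym_group_carrier)
    then show ?case using h by (simp add: permutes_inv)
  next
    case (eng h1 h2)
    then show ?case by (simp only: sym_group_mult permutes_compose)
  qed
  then show "u \<in> {u. u permutes block}" by simp
next
  fix u assume "u \<in> {u. u permutes block}"
  then obtain "is" where "is": "set is \<subseteq> {Suc p..<p + m}" "word_prod is = u"
    using ex_reduced_word by blast
  from "is"(1) have "word_prod is \<in> generate (sym_group N) (simple_refl ` {Suc p..<p + m})"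
  proof (induction "is")
    case Nil
    then show ?case using generate.one[of "sym_group N"] by (simp only: word_prod_simps sym_group_one)
  next
    case (Cons i "is")
    then have "simple_refl i \<in> generate (sym_group N) (simple_refl ` {Suc p..<p + m})"
      by (intro generate.incl) simp
    moreover have "word_prod is \<in> generate (sym_group N) (simple_refl ` {Suc p..<p + m})"
      using Cons by simp
    ultimately show ?case
      using generate.eng by (fastforce simp only: word_prod_simps rmult_def sym_group_mult)
  qed
  then show "u \<in> W_J lam" by (simp add: "is"(2) W_J_def J_lam sum_list_lam)
qed

lemma cox_length_block: "u permutes block \<Longrightarrow> cox_length N u = card (inversions u)"
  by (rule cox_length_eq) (rule permutes_block)

text \<open>The constant is the sum of the end points \<open>Suc p\<close> and \<open>p + m\<close>
  of the block.\<close>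

definition block_rev :: "nat \<Rightarrow> nat"
  where "block_rev k = (if k \<in> block then 2 * p + m + 1 - k else k)"

lemma block_rev_permutes: "block_rev permutes block"
  by (rule bij_imp_permutes, rule bij_betwI[of _ _ _ block_rev]) (auto simp: block_rev_def)

lemma inversions_block_rev: "inversions block_rev = {(i, j). Suc p \<le> i \<and> i < j \<and> j \<le> p + m}"
proof -
  have "(i, j) \<in> inversions block_rev \<longleftrightarrow> Suc p \<le> i \<and> i < j \<and> j \<le> p + m" for i j
  proof
    assume "(i, j) \<in> inversions block_rev"
    with subsetD[OF inversions_subset[OF block_rev_permutes] this]
    show "Suc p \<le> i \<and> i < j \<and> j \<le> p + m" by simp
  next
    assume "Suc p \<le> i \<and> i < j \<and> j \<le> p + m"
    then show "(i, j) \<in> inversions block_rev" by (auto simp: block_rev_def)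
  qed
  then show ?thesis by (intro equalityI subrelI) (simp_all only: mem_Collect_eq case_prod_conv)
qed

text \<open>The reversal inverts every pair in the block, so its inversion set contains that of each
  element of the subgroup. As \<open>arg_max\<close> selects some maximizer, uniqueness is needed
  too: a maximizer has the same inversion set and hence is equal.\<close>

lemma longest_J_lam: "longest_J lam = block_rev"
  unfolding longest_J_def W_J_lam sum_list_lam
proof (rule arg_maxI[where x = block_rev])
  have le: "inversions u \<subseteq> inversions block_rev" if "u permutes block" for u
    unfolding inversions_block_rev using inversions_subset[OF that] by (auto simp: inversions_def)
  show "block_rev \<in> {u. u permutes block}" using block_rev_permutes by simp
  show "\<not> cox_length N u > cox_length N block_rev" if "u \<in> {u. u permutes block}" for u
    using that card_mono[OF finite_inversions[OF block_rev_permutes] le] block_rev_permutes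
    by (simp add: cox_length_block not_less)
  fix u assume u: "u \<in> {u. u permutes block}"
    "\<forall>v. v \<in> {u. u permutes block} \<longrightarrow> \<not> cox_length N u < cox_length N v"
  then have "card (inversions block_rev) \<le> card (inversions u)"
    using block_rev_permutes by (simp add: cox_length_block not_less)
  then have "inversions u = inversions block_rev"
    using u(1) finite_inversions[OF block_rev_permutes] le by (simp add: card_seteq)
  then show "u = block_rev" using inversions_inject u(1) block_rev_permutes by blast
qed

text \<open>A descent inside the block could be removed by a simple reflection of the subgroup,
  which would give a shorter element of the coset. Conversely, if \<open>e\<close> increases on the
  block, moving positions by \<open>inv' u\<close> embeds its inversions into those of
  \<open>u \<Zsemi> e\<close>.\<close>

lemma X_J_lam:
  "X_J lam = {e. e permutes {1..N} \<and> (\<forall>i j. Suc p \<le> i \<and> i < j \<and> j \<le> p + m \<longrightarrow> e i < e j)}"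
proof (intro equalityI subsetI CollectI conjI allI impI)
  fix e assume e: "e \<in> X_J lam"
  then show perm: "e permutes {1..N}" by (simp add: X_J_def sum_list_lam sym_group_carrier)
  fix i j assume ij: "Suc p \<le> i \<and> i < j \<and> j \<le> p + m"
  show "e i < e j"
  proof (rule ccontr)
    assume "\<not> e i < e j"
    moreover have "e i \<noteq> e j" using ij permutes_inj[OF perm] by (simp add: inj_eq)
    ultimately obtain k where k: "i \<le> k" "k < j" "e (Suc k) < e k"
      using ex_adjacent_descent[of i j e] ij permutes_inj[OF perm] by auto
    have s: "simple_refl k permutes block" using k ij by (intro simple_refl_permutes) simp
    have perm': "simple_refl k \<Zsemi> e permutes {1..N}"
      unfolding rmult_def by (intro permutes_compose permutes_block s perm)
    have "cox_length N e \<le> cox_length N (simple_refl k \<Zsemi> e)"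
      using e s by (simp add: X_J_def sum_list_lam W_J_lam)
    moreover have "sym_diff {(k, Suc k)} (inversions e) = inversions e - {(k, Suc k)}"
      using k by auto
    ultimately have "card (inversions e) \<le> card (inversions e - {(k, Suc k)})"
      using card_inversions_simple_refl[OF permutes_inj[OF perm], of k] perm perm'
      by (simp add: cox_length_eq)
    moreover have "(k, Suc k) \<in> inversions e" using k by simp
    ultimately show False
      using card_Diff1_less[OF finite_inversions[OF perm], of "(k, Suc k)"] by simp
  qed
next
  fix e assume e: "e \<in> {e. e permutes {1..N} \<and>
    (\<forall>i j. Suc p \<le> i \<and> i < j \<and> j \<le> p + m \<longrightarrow> e i < e j)}"
  then have perm: "e permutes {1..N}" by simp
  have "cox_length N e \<le> cox_length N (u \<Zsemi> e)" if u: "u permutes block" for u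
  proof -
    have perm': "u \<Zsemi> e permutes {1..N}"
      unfolding rmult_def by (intro permutes_compose permutes_block u perm)
    note v = permutes_inv[OF u]
    have "card (inversions e) \<le> card (inversions (u \<Zsemi> e))"
    proof (rule card_inj_on_le)
      show "inj_on (map_prod (inv' u) (inv' u)) (inversions e)"
        using permutes_inj[OF v] prod.inj_map by (blast intro: inj_on_subset)
      show "map_prod (inv' u) (inv' u) ` inversions e \<subseteq> inversions (u \<Zsemi> e)"
      proof (rule image_subsetI)
        fix d assume "d \<in> inversions e"
        moreover obtain i j where d: "d = (i, j)" by (cases d)
        ultimately have ij: "(i, j) \<in> inversions e" by (simp only:)
        \<comment> \<open>\<open>inv' u\<close> maps the block to itself and fixes all other points,
          so it can reverse only pairs lying inside the block.\<close>
        have "\<not> (i \<in> block \<and> j \<in> block)" using e ij by fastforce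
        then have "inv' u i < inv' u j"
          using ij permutes_not_in[OF v, of i] permutes_not_in[OF v, of j]
            permutes_in_image[OF v, of i] permutes_in_image[OF v, of j]
          by (cases "i \<in> block"; cases "j \<in> block") auto
        then show "map_prod (inv' u) (inv' u) d \<in> inversions (u \<Zsemi> e)"
          using ij permutes_inverses(1)[OF u] by (simp add: d rmult_def)
      qed
      show "finite (inversions (u \<Zsemi> e))" using finite_inversions[OF perm'] .
    qed
    then show ?thesis using perm perm' by (simp add: cox_length_eq)
  qed
  then show "e \<in> X_J lam"
    using perm by (simp add: X_J_def sum_list_lam W_J_lam sym_group_carrier)
qed


section \<open>The set Z in terms of inversions\<close>

text \<open>
  These are the pairs that an \<open>e\<close> in \<open>Z lam\<close> may invert when its value at \<open>p + i\<close> separates those at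
  \<open>1, \<dots>, p\<close> from those at \<open>p + m + 1, \<dots>, N\<close>.
\<close>

definition maximal_inv :: "nat \<Rightarrow> (nat \<times> nat) set"
  where "maximal_inv i = {1..p} \<times> {p<..<p + i} \<union> {p + i<..p + m} \<times> {p + m<..N}"

lemma row_form_block_rev:
  "row_form N (block_rev \<Zsemi> e) =
    map e [1..<Suc p] @ rev (map e [Suc p..<Suc (p + m)]) @ map e [Suc (p + m)..<Suc N]"
proof -
  have "[1..<Suc N] = [1..<Suc p] @ [Suc p..<Suc (p + m)] @ [Suc (p + m)..<Suc N]"
    using upt_add_eq_append[of 1 "Suc p" "m + q"] upt_add_eq_append[of "Suc p" "Suc (p + m)" q]
    by (simp add: add.assoc del: upt_Suc)
  moreover have "map block_rev [Suc p..<Suc (p + m)] = rev [Suc p..<Suc (p + m)]"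
    by (rule nth_equalityI) (auto simp: rev_nth block_rev_def simp del: upt_Suc)
  moreover have "map block_rev [1..<Suc p] = [1..<Suc p]"
    "map block_rev [Suc (p + m)..<Suc N] = [Suc (p + m)..<Suc N]"
    by (auto intro!: map_idI simp: block_rev_def simp del: upt_Suc)
  ultimately have "map block_rev [1..<Suc N] =
    [1..<Suc p] @ rev [Suc p..<Suc (p + m)] @ [Suc (p + m)..<Suc N]"
    by (simp del: upt_Suc)
  then have "map e (map block_rev [1..<Suc N]) =
    map e ([1..<Suc p] @ rev [Suc p..<Suc (p + m)] @ [Suc (p + m)..<Suc N])"
    by (rule arg_cong)
  then show ?thesis by (simp add: row_form_def rmult_def rev_map del: upt_Suc)
qed

text \<open>Elements of \<open>X_J lam\<close> increase on the block, so reversing it gives the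
  decreasing middle word of \<open>new_rows_hook\<close>.\<close>

lemma new_rows_block_rev:
  assumes e: "e \<in> X_J lam"
  shows "new_rows [] (row_form N (block_rev \<Zsemi> e)) =
      replicate (Suc p) 0 @ [1..<m] @ replicate q 0 \<longleftrightarrow>
    (\<forall>i j. 1 \<le> i \<and> i < j \<and> j \<le> p \<longrightarrow> e i < e j) \<and>
    (\<forall>i j. p + m < i \<and> i < j \<and> j \<le> N \<longrightarrow> e i < e j) \<and>
    (\<exists>i\<in>{1..m}. e p < e (p + i) \<and> e (p + i) < e (Suc (p + m)))"
proof -
  let ?a = "map e [1..<Suc p]" and ?d = "rev (map e [Suc p..<Suc (p + m)])"
    and ?b = "map e [Suc (p + m)..<Suc N]"
  have inj: "inj e" using e permutes_inj by (auto simp: X_J_lam)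
  have "distinct (?a @ ?d @ ?b)"
    using inj_on_subset[OF inj] inj by (auto simp: distinct_map inj_eq simp del: upt_Suc)
  moreover have "sorted_wrt (>) ?d"
    using e by (auto simp: sorted_wrt_rev sorted_wrt_map_upt X_J_lam less_Suc_eq_le simp del: upt_Suc)
  moreover have "?a \<noteq> []" "?d \<noteq> []" "?b \<noteq> []" using p m q by simp_all
  moreover have "last ?a = e p" using p by simp
  moreover have "hd ?b = e (Suc (p + m))" using q by (simp add: hd_map del: upt_Suc)
  ultimately have "new_rows [] (row_form N (block_rev \<Zsemi> e)) =
      replicate (Suc p) 0 @ [1..<m] @ replicate q 0 \<longleftrightarrow>
    sorted_wrt (<) ?a \<and> sorted_wrt (<) ?b \<and>
    (\<exists>x\<in>set ?d. e p < x \<and> x < e (Suc (p + m)))"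
    using new_rows_hook[of ?a ?d ?b] by (simp add: row_form_block_rev del: upt_Suc replicate.simps)
  moreover have "(\<exists>x\<in>set ?d. e p < x \<and> x < e (Suc (p + m))) \<longleftrightarrow>
    (\<exists>i\<in>{1..m}. e p < e (p + i) \<and> e (p + i) < e (Suc (p + m)))" (is "?L \<longleftrightarrow> ?R")
  proof
    assume ?L
    then obtain k where k: "Suc p \<le> k" "k \<le> p + m" "e p < e k" "e k < e (Suc (p + m))"
      by (auto simp del: upt_Suc)
    then have "k - p \<in> {1..m}" "p + (k - p) = k" by auto
    then show ?R using k by metis
  next
    assume ?R
    then obtain i where i: "i \<in> {1..m}" "e p < e (p + i)" "e (p + i) < e (Suc (p + m))" by blast
    then have "e (p + i) \<in> set ?d" by (auto simp del: upt_Suc)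
    then show ?L using i by blast
  qed
  ultimately show ?thesis
    by (simp add: sorted_wrt_map_upt less_Suc_eq_le Suc_le_eq del: upt_Suc replicate.simps)
qed

lemma Z_lam: "Z lam = {e. e permutes {1..N} \<and> (\<exists>i\<in>{1..m}. inversions e \<subseteq> maximal_inv i)}"
proof -
  have X_id: "id \<in> X_J lam" by (simp add: X_J_lam permutes_id)
  \<comment> \<open>The identity satisfies the three conditions, so the listed sequence is the one
    of the longest element itself.\<close>
  have "new_rows [] (row_form N (block_rev \<Zsemi> id)) =
    replicate (Suc p) 0 @ [1..<m] @ replicate q 0"
    unfolding new_rows_block_rev[OF X_id] using m by force
  moreover have "block_rev \<Zsemi> id = block_rev" by (simp add: rmult_def)
  ultimately have rows: "new_rows [] (row_form N block_rev) =
    replicate (Suc p) 0 @ [1..<m] @ replicate q 0" by metis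
  have "e \<in> Z lam \<longleftrightarrow> e permutes {1..N} \<and> (\<exists>i\<in>{1..m}. inversions e \<subseteq> maximal_inv i)"
    if perm: "e permutes {1..N}" for e
  proof -
    have inj: "inj e" using perm permutes_inj by blast
    have less_iff: "e i < e j \<longleftrightarrow> (i, j) \<notin> inversions e" if "i < j" for i j
      using that inj_eq[OF inj, of i j] by auto
    have "e \<in> Z lam \<longleftrightarrow> e \<in> X_J lam \<and>
      (\<forall>i j. 1 \<le> i \<and> i < j \<and> j \<le> p \<longrightarrow> e i < e j) \<and>
      (\<forall>i j. p + m < i \<and> i < j \<and> j \<le> N \<longrightarrow> e i < e j) \<and>
      (\<exists>i\<in>{1..m}. e p < e (p + i) \<and> e (p + i) < e (Suc (p + m)))"
      using new_rows_block_rev[of e] rows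
      by (auto simp: Z_def sum_list_lam longest_J_lam right_cell_equiv_iff)
    also have "\<dots> \<longleftrightarrow> (\<exists>i\<in>{1..m}. inversions e \<subseteq> maximal_inv i)" (is "?L \<longleftrightarrow> ?R")
    proof
      assume L: ?L
      then obtain i where i: "i \<in> {1..m}" "e p < e (p + i)" "e (p + i) < e (Suc (p + m))" by blast
      have A: "e k < e l" if "1 \<le> k" "k < l" "l \<le> p" for k l using L that by blast
      have M: "e k < e l" if "p < k" "k < l" "l \<le> p + m" for k l
        using L that by (auto simp: X_J_lam)
      have B: "e k < e l" if "p + m < k" "k < l" "l \<le> N" for k l using L that by blast
      have "(k, l) \<in> maximal_inv i" if kl: "(k, l) \<in> inversions e" for k l
      proof -
        have kl': "k < l" "e l < e k" "1 \<le> k" "l \<le> N"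
          using kl subsetD[OF inversions_subset[OF perm] kl] by simp_all
        have a: "e k < e (p + i)" if "k \<le> p"
          using A[of k p] i(2) kl'(3) that by (cases "k = p") auto
        have b: "e (p + i) < e l" if "p + m < l"
          using B[of "Suc (p + m)" l] i(3) kl'(4) that by (cases "l = Suc (p + m)") auto
        have c: "e (p + i) \<le> e l" if "p + i \<le> l" "l \<le> p + m"
          using M[of "p + i" l] i(1) that by (cases "l = p + i") auto
        have d: "e k \<le> e (p + i)" if "p < k" "k \<le> p + i"
          using M[of k "p + i"] i(1) that by (cases "k = p + i") auto
        \<comment> \<open>The cases compare the pair with the three segments of positions. Only a
          pair with exactly one member in the block can be inverted, and the separating value
          \<open>e (p + i)\<close> confines that member to one side of \<open>p + i\<close>.\<close>
        consider "l \<le> p" | "k \<le> p" "p < l" "l \<le> p + m" | "k \<le> p" "p + m < l"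
          | "p < k" "l \<le> p + m" | "p < k" "k \<le> p + m" "p + m < l" | "p + m < k"
          using kl'(1) by linarith
        then show ?thesis
        proof cases
          case 1
          then show ?thesis using A[of k l] kl' by simp
        next
          case 2
          then show ?thesis using a c kl' by (force simp: maximal_inv_def)
        next
          case 3
          then show ?thesis using a b kl' by simp
        next
          case 4
          then show ?thesis using M[of k l] kl' by simp
        next
          case 5
          then show ?thesis using b d kl' by (force simp: maximal_inv_def)
        next
          case 6
          then show ?thesis using B[of k l] kl' by simp
        qed
      qed
      then have "inversions e \<subseteq> maximal_inv i" by auto
      then show ?R using i(1) by blast
    next
      assume ?R
      then obtain i where i: "i \<in> {1..m}" "inversions e \<subseteq> maximal_inv i" by blast
      then have less: "e k < e l" if "k < l" "(k, l) \<notin> maximal_inv i" for k l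
        using that less_iff by blast
      have "e p < e (p + i)" "e (p + i) < e (Suc (p + m))"
        using i(1) by (auto intro!: less simp: maximal_inv_def)
      moreover have "e \<in> X_J lam"
        using perm i(1) by (auto simp: X_J_lam maximal_inv_def intro!: less)
      ultimately show ?L
        using i(1) by (auto intro!: less bexI[of _ i] simp: maximal_inv_def)
    qed
    finally show ?thesis using perm by simp
  qed
  moreover have "e permutes {1..N}" if "e \<in> Z lam" for e
    using that by (simp add: Z_def X_J_lam)
  ultimately show ?thesis by blast
qed

end


section \<open>Conjugate compositions\<close>

lemma length_conjugate: "length (conjugate mu) = Max (insert 0 (set mu))"
  by (simp add: conjugate_def del: upt_Suc)

lemma nth_conjugate:
  "i < length (conjugate mu) \<Longrightarrow> conjugate mu ! i = card {j. j < length mu \<and> Suc i \<le> mu ! j}"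
  by (simp add: conjugate_def del: upt_Suc)

text \<open>A position of the largest part is counted in every entry.\<close>

lemma zero_notin_conjugate: "0 \<notin> set (conjugate mu)"
proof
  assume "0 \<in> set (conjugate mu)"
  then obtain i where i: "i < length (conjugate mu)" "conjugate mu ! i = 0"
    by (auto simp: in_set_conv_nth)
  have "Max (insert 0 (set mu)) \<in> insert 0 (set mu)" by (rule Max_in) auto
  with i(1) have "Max (insert 0 (set mu)) \<in> set mu" by (auto simp: length_conjugate)
  then obtain j where "j < length mu" "mu ! j = Max (insert 0 (set mu))"
    by (auto simp: in_set_conv_nth)
  then have "j \<in> {j. j < length mu \<and> Suc i \<le> mu ! j}" using i(1) by (simp add: length_conjugate)
  moreover have "card {j. j < length mu \<and> Suc i \<le> mu ! j} = 0" using i by (simp add: nth_conjugate)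
  ultimately show False by (auto simp: card_eq_0_iff)
qed

lemma nth_conjugate_0:
  assumes "0 \<notin> set mu" "0 < length (conjugate mu)"
  shows "conjugate mu ! 0 = length mu"
proof -
  have "{j. j < length mu \<and> Suc 0 \<le> mu ! j} = {..<length mu}"
    using assms(1) by (auto simp: Suc_le_eq in_set_conv_nth)
  then show ?thesis using assms(2) by (simp add: nth_conjugate)
qed

text \<open>The length of a conjugate is the largest part, and the largest part of
  \<open>conjugate mu\<close> is its first one, \<open>length mu\<close>. Thus the double conjugate
  of a column composition still shows the number of columns.\<close>

lemma length_conjugate_conjugate:
  assumes "0 \<notin> set mu"
  shows "length (conjugate (conjugate mu)) = length mu"
proof (cases "mu = []")
  case False
  then obtain x where x: "x \<in> set mu" "x \<noteq> 0" using assms by (cases mu) auto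
  then have "x \<le> Max (insert 0 (set mu))" by (intro Max_ge) auto
  then have pos: "0 < length (conjugate mu)" using x(2) unfolding length_conjugate by linarith
  have "Max (insert 0 (set (conjugate mu))) = length mu"
  proof (rule Max_eqI)
    show "length mu \<in> insert 0 (set (conjugate mu))"
      using nth_mem[OF pos] nth_conjugate_0[OF assms pos] by simp
    have "card {j. j < length mu \<and> P j} \<le> length mu" for P
      using card_mono[of "{..<length mu}" "{j. j < length mu \<and> P j}"] by auto
    then show "y \<le> length mu" if "y \<in> insert 0 (set (conjugate mu))" for y
      using that by (auto simp: in_set_conv_nth nth_conjugate)
  qed simp
  then show ?thesis by (simp add: length_conjugate)
qed (simp add: length_conjugate conjugate_def)

text \<open>The number of parts that are at least \<open>i\<close> depends only on the multiset of
  parts: \<open>k\<close> counts up to \<open>i = k\<close>, and the ones count only up to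
  \<open>i = 1\<close>.\<close>

lemma conjugate_hook:
  assumes "mset mu = mset (k # replicate l 1)" "1 \<le> k"
  shows "conjugate mu = Suc l # replicate (k - 1) 1"
proof -
  have "set mu = set (k # replicate l 1)" using assms(1) mset_eq_setD by blast
  then have Max: "Max (insert 0 (set mu)) = k" using assms(2) by (intro Max_eqI) auto
  have card: "card {j. j < length mu \<and> i \<le> mu ! j} = (if i \<le> k then 1 else 0) + (if i \<le> 1 then l else 0)"
    for i
  proof -
    have "card {j. j < length mu \<and> i \<le> mu ! j} = size (filter_mset ((\<le>) i) (mset mu))"
      by (simp only: mset_filter[symmetric] size_mset length_filter_conv_card)
    moreover have "size (filter_mset ((\<le>) i) (replicate_mset l 1)) = (if i \<le> 1 then l else 0)"
      by (induction l) auto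
    ultimately show ?thesis by (simp add: assms(1))
  qed
  show ?thesis
  proof (rule nth_equalityI)
    show len: "length (conjugate mu) = length (Suc l # replicate (k - 1) 1)"
      using assms(2) by (simp add: length_conjugate Max)
    fix i assume "i < length (conjugate mu)"
    then show "conjugate mu ! i = (Suc l # replicate (k - 1) 1) ! i"
      using len assms(2) by (cases i) (simp_all add: nth_conjugate card)
  qed
qed


section \<open>The permutation of a diagram\<close>

definition row_less :: "int \<times> int \<Rightarrow> int \<times> int \<Rightarrow> bool"
  where "row_less = (\<lambda>(a, b) (c, d). a < c \<or> a = c \<and> b < d)"

definition col_less :: "int \<times> int \<Rightarrow> int \<times> int \<Rightarrow> bool"
  where "col_less = (\<lambda>(a, b) (c, d). b < d \<or> b = d \<and> a < c)"

lemma t_row_eq: "t_row D d = card {d' \<in> D. row_less d' d \<or> d' = d}"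
  by (cases d) (auto simp: t_row_def row_less_def intro!: arg_cong[where f = card])

lemma t_col_eq: "t_col D d = card {d' \<in> D. col_less d' d \<or> d' = d}"
  by (cases d) (auto simp: t_col_def col_less_def intro!: arg_cong[where f = card])

lemma col_less_irrefl: "\<not> col_less d d"
  by (simp add: col_less_def split_beta)

lemma col_less_trans: "col_less c d \<Longrightarrow> col_less d e \<Longrightarrow> col_less c e"
  unfolding col_less_def split_beta by linarith

lemma col_less_total: "col_less d e \<or> d = e \<or> col_less e d"
  unfolding col_less_def split_beta prod_eq_iff by linarith

text \<open>Initial segments of a linear order are nested, so their sizes compare as their last
  elements do.\<close>

lemma t_col_less_iff:
  assumes "finite D" "d \<in> D" "e \<in> D"
  shows "t_col D d < t_col D e \<longleftrightarrow> col_less d e"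
proof -
  have mono: "t_col D d < t_col D e" if "col_less d e" "e \<in> D" for d e
    unfolding t_col_eq
  proof (rule psubset_card_mono)
    have "e \<notin> {d' \<in> D. col_less d' d \<or> d' = d}"
      using that(1) col_less_trans col_less_irrefl by blast
    moreover have "{d' \<in> D. col_less d' d \<or> d' = d} \<subseteq> {d' \<in> D. col_less d' e \<or> d' = e}"
      using that(1) col_less_trans by blast
    ultimately show "{d' \<in> D. col_less d' d \<or> d' = d} \<subset> {d' \<in> D. col_less d' e \<or> d' = e}"
      using that(2) by blast
  qed (use assms(1) in simp)
  show ?thesis
    using mono[of d e] mono[of e d] assms(2,3) col_less_total[of d e] col_less_irrefl[of e] by auto
qed

text \<open>An enumeration increasing in row order is inverse to \<open>t_row\<close>, so
  \<open>w_diag D k\<close> is the column rank of \<open>f k\<close>. The inversions are then read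
  off the column order without computing any value.\<close>

lemma w_diag_enumeration:
  assumes f: "bij_betw f {1..n} D"
    and mono: "\<And>k l. 1 \<le> k \<Longrightarrow> k < l \<Longrightarrow> l \<le> n \<Longrightarrow> row_less (f k) (f l)"
  shows "w_diag D permutes {1..n}"
    and "inversions (w_diag D) = {(k, l). 1 \<le> k \<and> k < l \<and> l \<le> n \<and> col_less (f l) (f k)}"
proof -
  have card: "card D = n" using bij_betw_same_card[OF f] by simp
  have fin: "finite D" using bij_betw_finite[OF f] by simp
  have fD: "f k \<in> D" if "k \<in> {1..n}" for k using f that by (auto dest: bij_betwE)
  have row: "t_row D (f k) = k" if k: "k \<in> {1..n}" for k
  proof -
    have "{d \<in> D. row_less d (f k) \<or> d = f k} = f ` {1..k}"
    proof (intro equalityI subsetI)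
      fix d assume d: "d \<in> {d \<in> D. row_less d (f k) \<or> d = f k}"
      then obtain l where l: "l \<in> {1..n}" "d = f l" using f by (auto simp: bij_betw_def)
      have "l \<le> k"
      proof (rule ccontr)
        assume "\<not> l \<le> k"
        then have "row_less (f k) (f l)" using mono[of k l] k l by simp
        then show False using d l by (auto simp: row_less_def)
      qed
      then show "d \<in> f ` {1..k}" using l by simp
    next
      fix d assume "d \<in> f ` {1..k}"
      then obtain l where l: "l \<in> {1..k}" "d = f l" by blast
      then show "d \<in> {d \<in> D. row_less d (f k) \<or> d = f k}"
        using mono[of l k] fD[of l] k by (cases "l = k") auto
    qed
    moreover have "inj_on f {1..k}"
      by (rule inj_on_subset[of f "{1..n}"]) (use f k in \<open>auto simp: bij_betw_def\<close>)
    ultimately show ?thesis by (simp add: t_row_eq card_image)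
  qed
  have inj: "inj_on (t_row D) D"
  proof (rule inj_on_inverseI)
    fix d assume "d \<in> D"
    then obtain k where "k \<in> {1..n}" "d = f k" using f by (auto simp: bij_betw_def)
    then show "f (t_row D d) = d" by (simp add: row)
  qed
  have w: "w_diag D k = t_col D (f k)" if "k \<in> {1..n}" for k
    using that the_inv_into_f_eq[OF inj row[OF that] fD[OF that]] by (simp add: w_diag_def card)
  have less: "w_diag D k < w_diag D l \<longleftrightarrow> col_less (f k) (f l)" if "k \<in> {1..n}" "l \<in> {1..n}" for k l
    using that fD by (simp add: w t_col_less_iff[OF fin])
  show perm: "w_diag D permutes {1..n}"
  proof (rule bij_imp_permutes)
    have "inj_on (w_diag D) {1..n}"
    proof (rule inj_onI)
      fix k l assume kl: "k \<in> {1..n}" "l \<in> {1..n}" "w_diag D k = w_diag D l"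
      then have "\<not> col_less (f k) (f l)" "\<not> col_less (f l) (f k)"
        using less[of k l] less[of l k] by simp_all
      then have "f k = f l" using col_less_total by blast
      then show "k = l" using kl f by (auto simp: bij_betw_def dest: inj_onD)
    qed
    \<comment> \<open>A column rank counts the node itself, so it is at least 1. An injective
      self-map of a finite set is onto.\<close>
    moreover have "w_diag D ` {1..n} \<subseteq> {1..n}"
    proof (rule image_subsetI)
      fix k assume k: "k \<in> {1..n}"
      have "f k \<in> {d' \<in> D. col_less d' (f k) \<or> d' = f k}" using fD[OF k] by simp
      moreover have "finite {d' \<in> D. col_less d' (f k) \<or> d' = f k}" using fin by simp
      ultimately have "0 < t_col D (f k)" unfolding t_col_eq card_gt_0_iff by blast
      moreover have "t_col D (f k) \<le> n"
        unfolding t_col_eq card[symmetric] using fin by (intro card_mono) auto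
      ultimately show "w_diag D k \<in> {1..n}" by (simp add: w[OF k])
    qed
    ultimately show "bij_betw (w_diag D) {1..n} {1..n}"
      by (simp add: bij_betw_def endo_inj_surj)
    fix k assume "k \<notin> {1..n}"
    then show "w_diag D k = k" by (simp only: w_diag_def card if_False)
  qed
  have "(k, l) \<in> inversions (w_diag D) \<longleftrightarrow> 1 \<le> k \<and> k < l \<and> l \<le> n \<and> col_less (f l) (f k)" for k l
  proof -
    have "k \<in> {1..n} \<and> l \<in> {1..n}" if "(k, l) \<in> inversions (w_diag D)"
      using subsetD[OF inversions_subset[OF perm] that] by simp
    then show ?thesis using less[of l k] by auto
  qed
  then show "inversions (w_diag D) = {(k, l). 1 \<le> k \<and> k < l \<and> l \<le> n \<and> col_less (f l) (f k)}"
    by (intro equalityI subrelI) (simp_all only: mem_Collect_eq case_prod_conv)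
qed


section \<open>Hook-shaped crosses\<close>

lemma is_partition_hook:
  assumes "1 \<le> m"
  shows "is_partition (m # replicate k 1)"
proof -
  have "sorted_wrt (\<ge>) (replicate k (1::nat))" by (induction k) auto
  then show ?thesis using assms by (auto simp: is_partition_def)
qed

context hook_composition
begin

definition cross :: "nat \<Rightarrow> diagram"
  where "cross i = {int p + 1} \<times> {1..int m} \<union> {1..int (p + q) + 1} \<times> {int i}"

text \<open>This is the enumeration of \<open>cross i\<close> in row order; position
  \<open>p + m + 1\<close> opens row \<open>p + 2\<close>.\<close>

definition node :: "nat \<Rightarrow> nat \<Rightarrow> int \<times> int"
  where "node i k =
    (if k \<le> p then (int k, int i)
     else if k \<le> p + m then (int p + 1, int k - int p)
     else (int k - int m + 1, int i))"

lemma bij_betw_node: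
  assumes "i \<in> {1..m}"
  shows "bij_betw (node i) {1..N} (cross i)"
proof (rule bij_betw_byWitness[where f' = "\<lambda>(a, b). nat (if a \<le> int p then a
      else if a = int p + 1 then int p + b else a + int m - 1)"])
  show "node i ` {1..N} \<subseteq> cross i"
    using assms by (auto simp: node_def cross_def)
qed (use assms in \<open>auto simp: node_def cross_def split: if_splits\<close>)

lemma row_less_node:
  assumes "k < l"
  shows "row_less (node i k) (node i l)"
  using assms by (auto simp: row_less_def node_def)

text \<open>Column order puts the long-row nodes left of column \<open>i\<close> before the nodes
  above that row, and those right of it after the nodes below. All other pairs keep their row
  order.\<close>

lemma inversions_cross:
  assumes "i \<in> {1..m}"
  shows "w_diag (cross i) permutes {1..N}" "inversions (w_diag (cross i)) = maximal_inv i"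
proof -
  show "w_diag (cross i) permutes {1..N}"
    by (rule w_diag_enumeration(1)[OF bij_betw_node[OF assms] row_less_node])
  have inv: "inversions (w_diag (cross i)) =
      {(k, l). 1 \<le> k \<and> k < l \<and> l \<le> N \<and> col_less (node i l) (node i k)}"
    by (rule w_diag_enumeration(2)[OF bij_betw_node[OF assms] row_less_node])
  have "1 \<le> k \<and> k < l \<and> l \<le> N \<and> col_less (node i l) (node i k) \<longleftrightarrow> (k, l) \<in> maximal_inv i" for k l
    using assms by (auto simp: col_less_def node_def maximal_inv_def)
  then show "inversions (w_diag (cross i)) = maximal_inv i"
    unfolding inv by (intro equalityI subrelI) (simp_all only: mem_Collect_eq case_prod_conv)
qed

section \<open>The maximal elements\<close>

lemma maximal_inv_subset:
  assumes "i \<in> {1..m}" "j \<in> {1..m}" "maximal_inv i \<subseteq> maximal_inv j"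
  shows "i = j"
proof (rule ccontr)
  assume "i \<noteq> j"
  \<comment> \<open>For \<open>j < i\<close> the witness pairs column \<open>j\<close> of the long
    row with the last single node above it, for \<open>i < j\<close> with the first one below; these
    nodes exist as \<open>p\<close> and \<open>q\<close> are positive.\<close>
  then consider "j < i" | "i < j" by linarith
  then show False
  proof cases
    case 1
    then have "(p, p + j) \<in> maximal_inv i" "(p, p + j) \<notin> maximal_inv j"
      using assms(1,2) p by (auto simp: maximal_inv_def)
    then show False using assms(3) by blast
  next
    case 2
    then have "(p + j, Suc (p + m)) \<in> maximal_inv i" "(p + j, Suc (p + m)) \<notin> maximal_inv j"
      using assms(1,2) q by (auto simp: maximal_inv_def)
    then show False using assms(3) by blast
  qed
qed

text \<open>Every element of \<open>Z lam\<close> is a prefix of the permutation of some cross, and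
  these permutations belong to \<open>Z lam\<close> and form an antichain.\<close>

lemma Y_lam: "Y lam = (\<lambda>i. w_diag (cross i)) ` {1..m}"
proof -
  let ?w = "\<lambda>i. w_diag (cross i)"
  have wZ: "?w i \<in> Z lam" if "i \<in> {1..m}" for i
    using inversions_cross[OF that] that by (auto simp: Z_lam)
  have prefix: "is_prefix N x y \<longleftrightarrow> inversions x \<subseteq> inversions y" if "x \<in> Z lam" "y \<in> Z lam" for x y
    using that by (intro is_prefix_iff) (auto simp: Z_lam)
  show ?thesis
  proof (intro equalityI subsetI)
    fix x assume "x \<in> Y lam"
    then have x: "x \<in> Z lam" "\<And>y. y \<in> Z lam \<Longrightarrow> is_prefix N x y \<Longrightarrow> y = x"
      by (auto simp: Y_def sum_list_lam)
    then obtain i where i: "i \<in> {1..m}" "inversions x \<subseteq> maximal_inv i" by (auto simp: Z_lam)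
    then have "is_prefix N x (?w i)" using prefix[OF x(1) wZ] inversions_cross by simp
    then show "x \<in> ?w ` {1..m}" using x(2) wZ i(1) by blast
  next
    fix x assume "x \<in> ?w ` {1..m}"
    then obtain i where i: "i \<in> {1..m}" "x = ?w i" by blast
    have "y = x" if y: "y \<in> Z lam" "is_prefix N x y" for y
    proof -
      obtain j where j: "j \<in> {1..m}" "inversions y \<subseteq> maximal_inv j" "y permutes {1..N}"
        using y(1) by (auto simp: Z_lam)
      have xy: "maximal_inv i \<subseteq> inversions y"
        using y(2) prefix[OF wZ y(1)] i inversions_cross(2) by simp
      then have "i = j" using maximal_inv_subset[OF i(1) j(1)] j(2) by blast
      then have "inversions y = inversions x" using xy j(2) i inversions_cross(2) by auto
      then show ?thesis using inversions_inject j(3) inversions_cross(1) i by blast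
    qed
    then show "x \<in> Y lam" using wZ i by (auto simp: Y_def sum_list_lam)
  qed
qed

lemma card_Y_lam: "card (Y lam) = m"
proof -
  have "inj_on (\<lambda>i. w_diag (cross i)) {1..m}"
  proof (rule inj_onI)
    fix i j assume ij: "i \<in> {1..m}" "j \<in> {1..m}" "w_diag (cross i) = w_diag (cross j)"
    then have "maximal_inv i = maximal_inv j"
      using inversions_cross(2)[OF ij(1)] inversions_cross(2)[OF ij(2)] by simp
    then show "i = j" using maximal_inv_subset[OF ij(1,2)] by simp
  qed
  then show ?thesis by (simp add: Y_lam card_image)
qed

section \<open>Crosses among the diagrams\<close>

lemma nth_lam: "j < Suc (p + q) \<Longrightarrow> lam ! j = (if j = p then m else 1)"
  by (auto simp: lam_def nth_append nth_Cons')

lemma mset_lam: "mset lam = mset (m # replicate (p + q) 1)"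
  by (simp add: lam_def replicate_add)

lemma nth_row_comp: "j < card (fst ` D) \<Longrightarrow> row_comp D ! j = card {b. (1 + int j, b) \<in> D}"
  by (simp add: row_comp_def)

lemma cross_row:
  "{b. (a, b) \<in> cross i} = (if a = int p + 1 then {1..int m} \<union> {int i}
    else if 1 \<le> a \<and> a \<le> int (p + q) + 1 then {int i} else {})"
  by (auto simp: cross_def)

lemma cross_col:
  "{a. (a, b) \<in> cross i} = (if b = int i then {1..int (p + q) + 1}
    else if 1 \<le> b \<and> b \<le> int m then {int p + 1} else {})"
  by (auto simp: cross_def)

lemma cross_proj:
  assumes "i \<in> {1..m}"
  shows "fst ` cross i = {1..int (Suc (p + q))}" "snd ` cross i = {1..int m}"
  using assms m by (auto simp: cross_def image_Un)

lemma cross_diagrams: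
  assumes "i \<in> {1..m}"
  shows "cross i \<in> diagrams lam"
proof -
  have "principal (cross i)"
    using cross_proj[OF assms] by (simp add: principal_def) (simp add: cross_def)
  moreover have "row_comp (cross i) = lam"
  proof (rule nth_equalityI)
    show len: "length (row_comp (cross i)) = length lam"
      by (simp add: row_comp_def cross_proj[OF assms] length_lam)
    fix j assume "j < length (row_comp (cross i))"
    then have j: "j < Suc (p + q)" by (simp add: len length_lam)
    have "{1..int m} \<union> {int i} = {1..int m}" using assms by auto
    then have "card {b. (1 + int j, b) \<in> cross i} = lam ! j"
      using j by (simp add: cross_row nth_lam)
    moreover have "row_comp (cross i) ! j = card {b. (1 + int j, b) \<in> cross i}"
      using j by (intro nth_row_comp) (simp add: cross_proj[OF assms])
    ultimately show "row_comp (cross i) ! j = lam ! j" by (simp only:)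
  qed
  ultimately show ?thesis by (simp add: diagrams_def)
qed

text \<open>Column \<open>i\<close> is full, and the other \<open>m - 1\<close> columns meet only
  the long row.\<close>

lemma mset_col_comp_cross:
  assumes "i \<in> {1..m}"
  shows "mset (col_comp (cross i)) = mset (Suc (p + q) # replicate (m - 1) 1)"
proof -
  have "mset [1..int m] = mset_set {1..int m}"
    using mset_set_set[OF distinct_upto[of 1 "int m"]] by simp
  then have "mset (col_comp (cross i)) =
    image_mset (\<lambda>b. card {a. (a, b) \<in> cross i}) (mset_set {1..int m})"
    by (simp add: col_comp_def cross_proj[OF assms])
  also have "mset_set {1..int m} = add_mset (int i) (mset_set ({1..int m} - {int i}))"
    using assms by (intro mset_set.remove) auto
  also have "image_mset (\<lambda>b. card {a. (a, b) \<in> cross i}) \<dots> = add_mset (Suc (p + q))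
      (image_mset (\<lambda>b. card {a. (a, b) \<in> cross i}) (mset_set ({1..int m} - {int i})))"
    by (simp add: cross_col[of "int i"] nat_add_distrib)
  also have "image_mset (\<lambda>b. card {a. (a, b) \<in> cross i}) (mset_set ({1..int m} - {int i})) =
    image_mset (\<lambda>_. 1) (mset_set ({1..int m} - {int i}))"
    by (rule image_mset_cong) (auto simp: cross_col)
  also have "\<dots> = replicate_mset (m - 1) 1"
    using assms by (simp add: image_mset_const_eq)
  finally show ?thesis by simp
qed

lemma special_cross:
  assumes i: "i \<in> {1..m}"
  shows "special (cross i)"
proof -
  let ?nu = "m # replicate (p + q) 1"
  have young: "young_diagram ?nu = {1} \<times> {1..int m} \<union> {1..int (p + q) + 1} \<times> {1}"
    using m by (auto simp: young_diagram_def nth_Cons' split: if_splits)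
  \<comment> \<open>The Young diagram of the hook is itself a cross, centred at
    \<open>(1, 1)\<close>; one swap of rows and one of columns move its centre to
    \<open>(int p + 1, int i)\<close>.\<close>
  let ?f = "transpose 1 (int p + 1)" and ?g = "transpose 1 (int i)"
  have f: "?f permutes {1..int (p + q) + 1}" and g: "?g permutes {1..int m}"
    using i by (auto intro!: permutes_swap_id)
  have "is_partition ?nu" using m by (intro is_partition_hook) simp
  moreover have "fst ` young_diagram ?nu = {1..int (p + q) + 1}" "snd ` young_diagram ?nu = {1..int m}"
    unfolding young using m by (auto simp: image_Un)
  moreover have "map_prod ?f ?g ` (A \<times> B) = ?f ` A \<times> ?g ` B" for A B
    by (intro map_prod_surj_on refl)
  then have "cross i = map_prod ?f ?g ` young_diagram ?nu"
    unfolding young image_Un cross_def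
    using permutes_image[OF f] permutes_image[OF g] by simp
  ultimately show ?thesis using f g unfolding special_def by metis
qed

text \<open>The double conjugate gives the number of columns, \<open>m\<close>, and the greatest
  column length, \<open>p + q + 1\<close>, which is the number of rows. A column of that length
  meets every row; it contains all the rows of size one, while the row of size \<open>m\<close>
  meets every column.\<close>

lemma diagrams_lam_conjugate_iff:
  "D \<in> diagrams lam \<and> conjugate (conjugate (col_comp D)) = conjugate lam \<longleftrightarrow>
    (\<exists>i\<in>{1..m}. D = cross i)"
proof (intro iffI conjI)
  assume D: "D \<in> diagrams lam \<and> conjugate (conjugate (col_comp D)) = conjugate lam"
  let ?mu = "col_comp D"
  have prin: "principal D" and row: "row_comp D = lam" using D by (auto simp: diagrams_def)
  have fin: "finite D" using prin by (simp add: principal_def)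
  have "length (row_comp D) = card (fst ` D)" by (simp add: row_comp_def)
  then have rows: "fst ` D = {1..int (Suc (p + q))}"
    using prin by (simp add: row length_lam principal_def)
  have cols: "snd ` D = {1..int (length ?mu)}"
    using prin by (simp add: principal_def col_comp_def)
  have finr: "finite {b. (a, b) \<in> D}" for a
    by (rule finite_subset[of _ "snd ` D"]) (use fin in force)+
  have finc: "finite {a. (a, b) \<in> D}" for b
    by (rule finite_subset[of _ "fst ` D"]) (use fin in force)+
  have cc: "conjugate (conjugate ?mu) = Suc (p + q) # replicate (m - 1) 1"
    using D conjugate_hook[OF mset_lam] m by simp
  have "set ?mu = (\<lambda>b. card {a. (a, b) \<in> D}) ` {1..int (card (snd ` D))}"
    by (simp add: col_comp_def)
  also have "{1..int (card (snd ` D))} = snd ` D"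
    using prin unfolding principal_def by (elim conjE) (rule sym)
  finally have set_mu: "set ?mu = (\<lambda>b. card {a. (a, b) \<in> D}) ` snd ` D" .
  have mu0: "0 \<notin> set ?mu"
  proof
    assume "0 \<in> set ?mu"
    then obtain d where d: "d \<in> D" "card {a. (a, snd d) \<in> D} = 0"
      unfolding set_mu by force
    then have "{a. (a, snd d) \<in> D} = {}" using finc[of "snd d"] by simp
    moreover have "fst d \<in> {a. (a, snd d) \<in> D}" using d(1) by simp
    ultimately show False by blast
  qed
  have len: "length ?mu = m"
    using length_conjugate_conjugate[OF mu0] cc m by simp
  \<comment> \<open>The first entry of the double conjugate is the length of
    \<open>conjugate ?mu\<close>, that is, the greatest column length. It is positive, so the
    default 0 is not the maximum.\<close>
  have "Max (insert 0 (set ?mu)) = Suc (p + q)"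
    using nth_conjugate_0[OF zero_notin_conjugate, of ?mu] cc by (simp add: length_conjugate)
  moreover have "Max (insert 0 (set ?mu)) \<in> insert 0 (set ?mu)" by (rule Max_in) auto
  ultimately have "Suc (p + q) \<in> set ?mu" by (metis insertE nat.distinct(1))
  then obtain b where b: "b \<in> {1..int m}" "card {a. (a, b) \<in> D} = Suc (p + q)"
    unfolding set_mu cols len by (elim imageE) simp
  define i where "i = nat b"
  have i: "i \<in> {1..m}" "b = int i" using b(1) by (auto simp: i_def)
  have col: "{a. (a, b) \<in> D} = {1..int (Suc (p + q))}"
  proof (rule card_subset_eq)
    show "{a. (a, b) \<in> D} \<subseteq> {1..int (Suc (p + q))}" unfolding rows[symmetric] by force
  qed (simp_all add: b(2))
  have card_row: "card {c. (1 + int j, c) \<in> D} = (if j = p then m else 1)" if "j < Suc (p + q)" for j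
  proof -
    have "row_comp D ! j = card {c. (1 + int j, c) \<in> D}"
      using that by (intro nth_row_comp) (simp add: rows)
    then show ?thesis unfolding row nth_lam[OF that] by (rule sym)
  qed
  have "(a, c) \<in> D \<longleftrightarrow> (a, c) \<in> cross i" for a c
  proof (cases "a \<in> {1..int (Suc (p + q))}")
    case False
    then have "a \<notin> fst ` D" "a \<notin> fst ` cross i" by (simp_all only: rows cross_proj[OF i(1)] not_False_eq_True)
    then show ?thesis by force
  next
    case True
    define j where "j = nat (a - 1)"
    have j: "a = 1 + int j" "j < Suc (p + q)" using True by (auto simp: j_def)
    \<comment> \<open>The full column has a node in row \<open>a\<close>, which determines a row of
      size one.\<close>
    have ab: "(a, b) \<in> D" using True col by blast
    have "{c. (a, c) \<in> D} = (if j = p then {1..int m} else {b})"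
    proof (cases "j = p")
      case True
      have "{c. (a, c) \<in> D} = {1..int m}"
      proof (rule card_subset_eq)
        show "{c. (a, c) \<in> D} \<subseteq> {1..int m}" unfolding len[symmetric] cols[symmetric] by force
        show "card {c. (a, c) \<in> D} = card {1..int m}" using card_row[OF j(2)] j(1) True by simp
      qed simp
      then show ?thesis using True by simp
    next
      case False
      then have "card {c. (a, c) \<in> D} = 1" using card_row[OF j(2)] j(1) by simp
      then obtain x where "{c. (a, c) \<in> D} = {x}" by (rule card_1_singletonE)
      then show ?thesis using ab False by auto
    qed
    also have "\<dots> = {c. (a, c) \<in> cross i}"
      using j i by (auto simp: cross_row)
    finally show ?thesis by blast
  qed
  then have "D = cross i" by (intro equalityI subrelI) blast+
  then show "\<exists>i\<in>{1..m}. D = cross i" using i(1) by blast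
next
  assume "\<exists>i\<in>{1..m}. D = cross i"
  then obtain i where i: "i \<in> {1..m}" "D = cross i" by blast
  then show "D \<in> diagrams lam" using cross_diagrams by blast
  have "conjugate (col_comp D) = m # replicate (p + q) 1"
    using conjugate_hook[OF mset_col_comp_cross[OF i(1)]] m i by simp
  then show "conjugate (conjugate (col_comp D)) = conjugate lam"
    using conjugate_hook[of "m # replicate (p + q) 1" m "p + q"] conjugate_hook[OF mset_lam] m by simp
qed

lemma Y_lam_eq:
  "Y lam = {w_diag D | D. D \<in> diagrams lam \<and> conjugate (conjugate (col_comp D)) = conjugate lam}"
  unfolding diagrams_lam_conjugate_iff Y_lam by blast

lemma Y_lam_special: "Y lam = Y_s lam"
proof -
  have "Y lam \<subseteq> Z lam" by (auto simp: Y_def)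
  moreover have "\<exists>D\<in>diagrams lam. special D \<and> e = w_diag D" if "e \<in> Y lam" for e
    using that cross_diagrams special_cross unfolding Y_lam by blast
  ultimately show ?thesis by (auto simp: Y_s_def Z_s_def)
qed

end

section \<open>Arbitrary rearrangements of a hook\<close>

theorem proposition3p10:
  fixes n m r :: nat and lam :: "nat list"
  assumes "is_composition n lam"
    and "mset lam = mset (m # replicate (r - 1) 1)"
    and "m > 1" and "r \<ge> 3"
    and "\<not> is_partition lam" and "\<not> is_partition (rev lam)"
  shows "Y lam = {w_diag D | D. D \<in> diagrams lam \<and>
                    conjugate (conjugate (col_comp D)) = conjugate lam}
         \<and> Y lam = Y_s lam
         \<and> card (Y lam) = m"
proof -
  \<comment> \<open>Cutting \<open>lam\<close> at an occurrence of \<open>m\<close> leaves only ones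
    on both sides.\<close>
  have "m \<in> set lam" using assms(2) by (metis list.set_intros(1) mset_eq_setD)
  then obtain xs ys where lam: "lam = xs @ m # ys" by (meson split_list)
  have ones: "mset xs + mset ys = replicate_mset (r - 1) 1" using assms(2) lam by simp
  define p q where "p = length xs" and "q = length ys"
  have "x = 1" if "x \<in> set xs \<union> set ys" for x
  proof -
    have "x \<in># mset xs + mset ys" using that by auto
    then show ?thesis unfolding ones by (simp split: if_splits)
  qed
  then have "xs = replicate p 1" "ys = replicate q 1"
    by (auto simp: p_def q_def intro!: replicate_eqI)
  with lam have lam: "lam = replicate p 1 @ m # replicate q 1" by simp
  have hook: "is_partition (m # replicate k 1)" for k
    using assms(3) by (intro is_partition_hook) simp
  have "p \<noteq> 0"
  proof
    assume "p = 0"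
    then have "lam = m # replicate q 1" by (simp add: lam)
    then show False using assms(5) hook by simp
  qed
  moreover have "q \<noteq> 0"
  proof
    assume "q = 0"
    then have "rev lam = m # replicate p 1" by (simp add: lam)
    then show False using assms(6) hook by simp
  qed
  ultimately interpret H: hook_composition p m q
    using assms(3) by unfold_locales auto
  have "lam = H.lam" by (simp add: lam H.lam_def)
  then show ?thesis using H.Y_lam_eq H.Y_lam_special H.card_Y_lam by simp
qed

end
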